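(* Let $U_1,\dots,U_r$ be $\mathfrak{g}$-modules and let $z_1,\dots,z_r$ be nonzero complex numbers. Then on the tensor product $\hat{\mathfrak{g}}[\sigma]$-module $U_1(z_1)\otimes\cdots\otimes U_r(z_r)$, $$(x-z_1)\cdots(x-z_r)a(x)=0\quad\text{for all }a\in\mathfrak{g}.$$ In particular, the evaluation $\hat{\mathfrak{g}}[\sigma]$-module $U_1(z_1)\otimes\cdots\otimes U_r(z_r)$ is in the category $\mathcal{E}$.
   Context: Let $\mathfrak{g}$ be a finite-dimensional simple Lie algebra over $\mathbb{C}$ with the nondegenerate symmetric invariant bilinear form $\langle\cdot,\cdot\rangle$ normalized so that the squared length of the longest roots is $2$. Let $\sigma$ be an automorphism of $\mathfrak{g}$ of order $N$, $\varepsilon=\exp(2\pi \sqrt{-1}/N)$, and $\mathfrak{g}_i=\{a\in\mathfrak{g}\mid \sigma(a)=\varepsilon^i a\}$ for $0\le i\le N-1$, so $\mathfrak{g}=\bigoplus_{i=0}^{N-1}\mathfrak{g}_i$. The twisted affine Lie algebra is $\hat{\mathfrak{g}}[\sigma]=\bigoplus_{i=0}^{N-1}\mathfrak{g}_i\otimes t^{i/N}\mathbb{C}[t,t^{-1}]\oplus\mathbb{C}\mathbf{k}$ with $\mathbf{k}$ a nonzero central element and $[a\otimes t^{m+i/N},b\otimes t^{n+j/N}]=[a,b]\otimes t^{m+n+(i+j)/N}+(m+\tfrac{i}{N})\langle a,b\rangle\delta_{m+i/N,\,-n-j/N}\mathbf{k}$ for $a\in\mathfrak{g}_i$, $b\in\mathfrak{g}_j$,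 $m,n\in\mathbb{Z}$. For $a\in\mathfrak{g}_i$ put $a(x)=\sum_{n\in\mathbb{Z}}(a\otimes t^{n+i/N})x^{-n-i/N-1}$, extended linearly to all $a\in\mathfrak{g}$. Evaluation modules: for each nonzero complex number $z$ fix an $N$-th root $z^{1/N}$. For a $\mathfrak{g}$-module $U$, $U(z)$ is the space $U$ with the $\hat{\mathfrak{g}}[\sigma]$-action $(a\otimes t^{n+i/N})u=z^{n+i/N}(au)$ for $a\in\mathfrak{g}_i$, $n\in\mathbb{Z}$, $u\in U$ (where $z^{n+i/N}=z^n(z^{1/N})^i$), and $\mathbf{k}U=0$. A tensor product $U_1(z_1)\otimes\cdots\otimes U_r(z_r)$ is called an evaluation module. Category $\mathcal{E}$: the $\hat{\mathfrak{g}}[\sigma]$-modules $W$ for which there exists a nonzero polynomial $p(x)\in\mathbb{C}[x]$, depending on $W$, such that $p(x)a(x)w=0$ for all $a\in\mathfrak{g}$, $w\in W$. *)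

theory Defs
  imports
    Complex_Main
    "HOL-Computational_Algebra.Polynomial"
    "HOL-Algebra.AbelCoset"
    "Jordan_Normal_Form.VS_Connect"
begin

section \<open>Complex Lie algebras and their modules\<close>

abbreviation complex_ring :: "complex ring" (\<open>\<complex>\<close>)
  where "complex_ring \<equiv> class_ring"

text \<open>
  A Lie algebra is a \<^type>\<open>module\<close> record over \<open>\<complex>\<close> with a bracket.  The fields \<^const>\<open>mult\<close> and
  \<^const>\<open>one\<close>, inherited from rings, carry no meaning in a vector space.
\<close>

record 'g lie_alg = "(complex, 'g) module" +
  bracket :: "'g \<Rightarrow> 'g \<Rightarrow> 'g"

locale lie_algebra = vectorspace \<complex> L
  for L :: "('g, 'm) lie_alg_scheme" (structure) +
  assumes bracket_closed:
      "\<lbrakk>x \<in> carrier L; y \<in> carrier L\<rbrakk> \<Longrightarrow> bracket L x y \<in> carrier L"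
    and bracket_add_left:
      "\<lbrakk>x \<in> carrier L; y \<in> carrier L; w \<in> carrier L\<rbrakk>
        \<Longrightarrow> bracket L (x \<oplus> y) w = bracket L x w \<oplus> bracket L y w"
    and bracket_add_right:
      "\<lbrakk>x \<in> carrier L; y \<in> carrier L; w \<in> carrier L\<rbrakk>
        \<Longrightarrow> bracket L w (x \<oplus> y) = bracket L w x \<oplus> bracket L w y"
    and bracket_smult_left:
      "\<lbrakk>x \<in> carrier L; y \<in> carrier L\<rbrakk> \<Longrightarrow> bracket L (c \<odot> x) y = c \<odot> bracket L x y"
    and bracket_smult_right:
      "\<lbrakk>x \<in> carrier L; y \<in> carrier L\<rbrakk> \<Longrightarrow> bracket L x (c \<odot> y) = c \<odot> bracket L x y"
    and bracket_self: "x \<in> carrier L \<Longrightarrow> bracket L x x = \<zero>"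
    and jacobi:
      "\<lbrakk>x \<in> carrier L; y \<in> carrier L; w \<in> carrier L\<rbrakk>
        \<Longrightarrow> bracket L x (bracket L y w) \<oplus> bracket L y (bracket L w x)
              \<oplus> bracket L w (bracket L x y) = \<zero>"

locale lie_module = lie_algebra L + M: vectorspace \<complex> M
  for L :: "('g, 'm) lie_alg_scheme" and M :: "(complex, 'u, 'n) module_scheme" +
  fixes act :: "'g \<Rightarrow> 'u \<Rightarrow> 'u"
  assumes act_closed: "\<lbrakk>x \<in> carrier L; u \<in> carrier M\<rbrakk> \<Longrightarrow> act x u \<in> carrier M"
    and act_add_left:
      "\<lbrakk>x \<in> carrier L; y \<in> carrier L; u \<in> carrier M\<rbrakk>
        \<Longrightarrow> act (x \<oplus>\<^bsub>L\<^esub> y) u = act x u \<oplus>\<^bsub>M\<^esub> act y u"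
    and act_add_right:
      "\<lbrakk>x \<in> carrier L; u \<in> carrier M; v \<in> carrier M\<rbrakk>
        \<Longrightarrow> act x (u \<oplus>\<^bsub>M\<^esub> v) = act x u \<oplus>\<^bsub>M\<^esub> act x v"
    and act_smult_left:
      "\<lbrakk>x \<in> carrier L; u \<in> carrier M\<rbrakk> \<Longrightarrow> act (c \<odot>\<^bsub>L\<^esub> x) u = c \<odot>\<^bsub>M\<^esub> act x u"
    and act_smult_right:
      "\<lbrakk>x \<in> carrier L; u \<in> carrier M\<rbrakk> \<Longrightarrow> act x (c \<odot>\<^bsub>M\<^esub> u) = c \<odot>\<^bsub>M\<^esub> act x u"
    and act_bracket:
      "\<lbrakk>x \<in> carrier L; y \<in> carrier L; u \<in> carrier M\<rbrakk>
        \<Longrightarrow> act (bracket L x y) u = act x (act y u) \<ominus>\<^bsub>M\<^esub> act y (act x u)"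

definition lie_ideal :: "('g, 'm) lie_alg_scheme \<Rightarrow> 'g set \<Rightarrow> bool"
  where "lie_ideal L I \<longleftrightarrow>
    VectorSpace.subspace \<complex> I L \<and> (\<forall>x\<in>carrier L. \<forall>y\<in>I. bracket L x y \<in> I)"

locale simple_lie_algebra = lie_algebra +
  assumes non_abelian: "\<exists>x\<in>carrier L. \<exists>y\<in>carrier L. bracket L x y \<noteq> \<zero>"
    and ideals_trivial: "lie_ideal L I \<Longrightarrow> I = {\<zero>} \<or> I = carrier L"


section \<open>Roots and the normalized invariant form\<close>

definition lie_subalgebra :: "('g, 'm) lie_alg_scheme \<Rightarrow> 'g set \<Rightarrow> bool"
  where "lie_subalgebra L H \<longleftrightarrow>
    VectorSpace.subspace \<complex> H L \<and> (\<forall>x\<in>H. \<forall>y\<in>H. bracket L x y \<in> H)"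

primrec lower_central :: "('g, 'm) lie_alg_scheme \<Rightarrow> 'g set \<Rightarrow> nat \<Rightarrow> 'g set"
  where
    "lower_central L H 0 = H"
  | "lower_central L H (Suc n) =
      LinearCombinations.module.span \<complex> L {bracket L x y | x y. x \<in> H \<and> y \<in> lower_central L H n}"

text \<open>A Cartan subalgebra is a nilpotent subalgebra that is its own normalizer.\<close>

definition cartan_subalgebra :: "('g, 'm) lie_alg_scheme \<Rightarrow> 'g set \<Rightarrow> bool"
  where "cartan_subalgebra L H \<longleftrightarrow>
    lie_subalgebra L H \<and>
    (\<exists>n. lower_central L H n = {\<zero>\<^bsub>L\<^esub>}) \<and>
    {x \<in> carrier L. \<forall>h\<in>H. bracket L x h \<in> H} = H"

text \<open>
  Roots are functions on \<open>H\<close>, made \<^const>\<open>undefined\<close> outside \<open>H\<close> so that they are determined by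
  their values on \<open>H\<close>.  Linearity need not be required: the eigenvalue of \<open>h\<close> on a common
  eigenvector depends linearly on \<open>h\<close>.
\<close>

definition roots :: "('g, 'm) lie_alg_scheme \<Rightarrow> 'g set \<Rightarrow> ('g \<Rightarrow> complex) set"
  where "roots L H =
    {\<alpha> \<in> extensional H. (\<exists>h\<in>H. \<alpha> h \<noteq> 0) \<and>
      (\<exists>x\<in>carrier L. x \<noteq> \<zero>\<^bsub>L\<^esub> \<and> (\<forall>h\<in>H. bracket L h x = \<alpha> h \<odot>\<^bsub>L\<^esub> x))}"

text \<open>
  The form that \<open>B\<close> induces on the dual of \<open>H\<close>, at \<open>(\<alpha>, \<alpha>)\<close>: it is \<open>B t t\<close>
  for the element \<open>t\<close> of \<open>H\<close> that represents \<open>\<alpha>\<close> through \<open>B\<close>.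
\<close>

definition root_sq_length :: "'g set \<Rightarrow> ('g \<Rightarrow> 'g \<Rightarrow> complex) \<Rightarrow> ('g \<Rightarrow> complex) \<Rightarrow> complex"
  where "root_sq_length H B \<alpha> =
    (let t = (THE t. t \<in> H \<and> (\<forall>h\<in>H. B t h = \<alpha> h)) in B t t)"

locale invariant_form = lie_algebra +
  fixes B :: "'a \<Rightarrow> 'a \<Rightarrow> complex"
  assumes form_add:
      "\<lbrakk>x \<in> carrier L; y \<in> carrier L; w \<in> carrier L\<rbrakk> \<Longrightarrow> B (x \<oplus> y) w = B x w + B y w"
    and form_smult: "\<lbrakk>x \<in> carrier L; y \<in> carrier L\<rbrakk> \<Longrightarrow> B (c \<odot> x) y = c * B x y"
    and form_sym: "\<lbrakk>x \<in> carrier L; y \<in> carrier L\<rbrakk> \<Longrightarrow> B x y = B y x"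
    and form_invariant:
      "\<lbrakk>x \<in> carrier L; y \<in> carrier L; w \<in> carrier L\<rbrakk>
        \<Longrightarrow> B (bracket L x y) w = B x (bracket L y w)"
    and form_nondegenerate:
      "\<lbrakk>x \<in> carrier L; \<forall>y\<in>carrier L. B x y = 0\<rbrakk> \<Longrightarrow> x = \<zero>"

text \<open>Cartan subalgebras are conjugate, so the choice of \<open>H\<close> does not matter.\<close>

locale normalized_invariant_form = invariant_form +
  assumes longest_roots: "\<exists>H. cartan_subalgebra L H \<and>
      (\<exists>\<alpha>\<in>roots L H. root_sq_length H B \<alpha> = 2) \<and>
      (\<forall>\<alpha>\<in>roots L H. root_sq_length H B \<alpha> \<in> \<real> \<and> Re (root_sq_length H B \<alpha>) \<le> 2)"


section \<open>The twisted affine Lie algebra\<close>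

definition lie_automorphism :: "('g, 'm) lie_alg_scheme \<Rightarrow> ('g \<Rightarrow> 'g) \<Rightarrow> bool"
  where "lie_automorphism L \<sigma> \<longleftrightarrow>
    linear_map \<complex> L L \<sigma> \<and> bij_betw \<sigma> (carrier L) (carrier L) \<and>
    (\<forall>x\<in>carrier L. \<forall>y\<in>carrier L. \<sigma> (bracket L x y) = bracket L (\<sigma> x) (\<sigma> y))"

definition has_order :: "('g, 'm) lie_alg_scheme \<Rightarrow> ('g \<Rightarrow> 'g) \<Rightarrow> nat \<Rightarrow> bool"
  where "has_order L \<sigma> N \<longleftrightarrow>
    N > 0 \<and> (\<forall>x\<in>carrier L. (\<sigma> ^^ N) x = x) \<and>
    (\<forall>m. 0 < m \<and> m < N \<longrightarrow> (\<exists>x\<in>carrier L. (\<sigma> ^^ m) x \<noteq> x))"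

text \<open>The eigenspace \<open>\<gg>\<^sub>i\<close>; it depends on \<open>i\<close> only modulo \<open>N\<close>.\<close>

definition eigenspace :: "('g, 'm) lie_alg_scheme \<Rightarrow> ('g \<Rightarrow> 'g) \<Rightarrow> nat \<Rightarrow> int \<Rightarrow> 'g set"
  where "eigenspace L \<sigma> N i =
    {a \<in> carrier L. \<sigma> a = (exp (2 * of_real pi * \<i> / of_nat N) powi i) \<odot>\<^bsub>L\<^esub> a}"

text \<open>The \<open>\<gg>\<^sub>i\<close>-component of \<open>a\<close> in the decomposition of \<open>\<gg>\<close> into eigenspaces of \<open>\<sigma>\<close>.\<close>

definition component :: "('g, 'm) lie_alg_scheme \<Rightarrow> ('g \<Rightarrow> 'g) \<Rightarrow> nat \<Rightarrow> 'g \<Rightarrow> int \<Rightarrow> 'g"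
  where "component L \<sigma> N a =
    (THE c. c \<in> (\<Pi>\<^sub>E i\<in>{0..<int N}. eigenspace L \<sigma> N i) \<and> a = (\<Oplus>\<^bsub>L\<^esub>i\<in>{0..<int N}. c i))"

text \<open>
  An element of \<open>\<gg>^[\<sigma>]\<close> is a pair \<open>(f, c)\<close> standing for \<open>\<Sum>k. f k \<otimes> t^(k/N) + c \<^bold>k\<close>: exponents
  in \<open>(1/N)\<int>\<close> are written as integers \<open>k = n N + i\<close>, and the condition on the coefficients is
  \<open>f k \<in> \<gg>\<^sub>i\<close> with \<open>i = k mod N\<close>.  The bracket is the bilinear extension of
  \<open>[a \<otimes> t^(p/N), b \<otimes> t^(q/N)] = [a,b] \<otimes> t^((p+q)/N) + (p/N) \<langle>a,b\<rangle> \<delta>\<^sub>p\<^sub>,\<^sub>-\<^sub>q \<^bold>k\<close>.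
\<close>

definition lsupp :: "('g, 'm) lie_alg_scheme \<Rightarrow> (int \<Rightarrow> 'g) \<times> complex \<Rightarrow> int set"
  where "lsupp L X = {k. fst X k \<noteq> \<zero>\<^bsub>L\<^esub>}"

definition twisted_affine ::
    "('g, 'm) lie_alg_scheme \<Rightarrow> ('g \<Rightarrow> 'g \<Rightarrow> complex) \<Rightarrow> ('g \<Rightarrow> 'g) \<Rightarrow> nat
      \<Rightarrow> ((int \<Rightarrow> 'g) \<times> complex) lie_alg"
  where "twisted_affine L B \<sigma> N =
    \<lparr>carrier = {X. (\<forall>k. fst X k \<in> eigenspace L \<sigma> N k) \<and> finite (lsupp L X)},
     mult = undefined,
     one = undefined,
     zero = (\<lambda>_. \<zero>\<^bsub>L\<^esub>, 0),
     add = (\<lambda>X Y. (\<lambda>k. fst X k \<oplus>\<^bsub>L\<^esub> fst Y k, snd X + snd Y)),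
     smult = (\<lambda>c X. (\<lambda>k. c \<odot>\<^bsub>L\<^esub> fst X k, c * snd X)),
     bracket = (\<lambda>X Y.
       (\<lambda>k. \<Oplus>\<^bsub>L\<^esub>p\<in>lsupp L X. bracket L (fst X p) (fst Y (k - p)),
        \<Sum>p\<in>lsupp L X. (of_int p / of_nat N) * B (fst X p) (fst Y (- p))))\<rparr>"

text \<open>The element \<open>a \<otimes> t^(k/N)\<close>, for \<open>a \<in> \<gg>\<^sub>k\<close>.\<close>

definition loop_elt :: "('g, 'm) lie_alg_scheme \<Rightarrow> 'g \<Rightarrow> int \<Rightarrow> (int \<Rightarrow> 'g) \<times> complex"
  where "loop_elt L a k = (\<lambda>j. if j = k then a else \<zero>\<^bsub>L\<^esub>, 0)"

text \<open>
  Formal series in \<open>x^(1/N)\<close>, infinite in both directions, are functions on \<^typ>\<open>int\<close>; the value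
  at \<open>e\<close> is the coefficient of \<open>x^(e/N)\<close>.  In \<open>a(x)\<close> the element \<open>a\<^sub>i \<otimes> t^(k/N)\<close> with
  \<open>i = k mod N\<close> is the coefficient of \<open>x^(-k/N-1)\<close>, that is \<open>e = -k - N\<close>.
\<close>

definition current ::
    "('g, 'm) lie_alg_scheme \<Rightarrow> ('g \<Rightarrow> 'g) \<Rightarrow> nat \<Rightarrow> 'g \<Rightarrow> int \<Rightarrow> (int \<Rightarrow> 'g) \<times> complex"
  where "current L \<sigma> N a e =
    (let k = - e - int N in loop_elt L (component L \<sigma> N a (k mod int N)) k)"

text \<open>The product \<open>p(x) S(x)\<close>, where \<open>x\<close> shifts exponents by \<open>N\<close> in units of \<open>1/N\<close>.\<close>

definition poly_times_series ::
    "(complex, 'u, 'n) module_scheme \<Rightarrow> nat \<Rightarrow> complex poly \<Rightarrow> (int \<Rightarrow> 'u) \<Rightarrow> int \<Rightarrow> 'u"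
  where "poly_times_series M N p S e =
    (\<Oplus>\<^bsub>M\<^esub>m\<in>{..degree p}. coeff p m \<odot>\<^bsub>M\<^esub> S (e - int m * int N))"

text \<open>\<open>p(x) a(x) = 0\<close> on the \<open>\<gg>^[\<sigma>]\<close>-module \<open>W\<close>, for all \<open>a \<in> \<gg>\<close>.\<close>

definition annihilates_currents ::
    "('g, 'm) lie_alg_scheme \<Rightarrow> ('g \<Rightarrow> 'g) \<Rightarrow> nat \<Rightarrow> complex poly
      \<Rightarrow> (complex, 'w, 'n) module_scheme \<Rightarrow> ((int \<Rightarrow> 'g) \<times> complex \<Rightarrow> 'w \<Rightarrow> 'w) \<Rightarrow> bool"
  where "annihilates_currents L \<sigma> N p W act \<longleftrightarrow>
    (\<forall>a\<in>carrier L. \<forall>w\<in>carrier W. \<forall>e.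
      poly_times_series W N p (\<lambda>e'. act (current L \<sigma> N a e') w) e = \<zero>\<^bsub>W\<^esub>)"

definition category_E ::
    "('g, 'm) lie_alg_scheme \<Rightarrow> ('g \<Rightarrow> 'g \<Rightarrow> complex) \<Rightarrow> ('g \<Rightarrow> 'g) \<Rightarrow> nat
      \<Rightarrow> (complex, 'w, 'n) module_scheme \<Rightarrow> ((int \<Rightarrow> 'g) \<times> complex \<Rightarrow> 'w \<Rightarrow> 'w) \<Rightarrow> bool"
  where "category_E L B \<sigma> N W act \<longleftrightarrow>
    lie_module (twisted_affine L B \<sigma> N) W act \<and>
    (\<exists>p. p \<noteq> 0 \<and> annihilates_currents L \<sigma> N p W act)"


section \<open>Evaluation modules\<close>

text \<open>
  The action on \<open>U(z)\<close>, for the root \<open>\<zeta> = z^(1/N)\<close>; the second component of \<open>X\<close>, the coefficient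
  of \<open>\<^bold>k\<close>, acts by zero.
\<close>

definition eval_act ::
    "('g, 'm) lie_alg_scheme \<Rightarrow> nat \<Rightarrow> (complex, 'u, 'n) module_scheme \<Rightarrow> ('g \<Rightarrow> 'u \<Rightarrow> 'u)
      \<Rightarrow> complex \<Rightarrow> complex \<Rightarrow> (int \<Rightarrow> 'g) \<times> complex \<Rightarrow> 'u \<Rightarrow> 'u"
  where "eval_act L N U act z \<zeta> X u =
    (\<Oplus>\<^bsub>U\<^esub>k\<in>lsupp L X.
      (z powi (k div int N) * \<zeta> ^ nat (k mod int N)) \<odot>\<^bsub>U\<^esub> act (fst X k) u)"


section \<open>Tensor products\<close>

definition free_vs :: "'s set \<Rightarrow> (complex, 's \<Rightarrow> complex) module"
  where "free_vs S =
    \<lparr>carrier = {f. finite {s. f s \<noteq> 0} \<and> (\<forall>s. s \<notin> S \<longrightarrow> f s = 0)},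
     mult = undefined,
     one = undefined,
     zero = (\<lambda>_. 0),
     add = (\<lambda>f g s. f s + g s),
     smult = (\<lambda>c f s. c * f s)\<rparr>"

definition single :: "'s \<Rightarrow> 's \<Rightarrow> complex"
  where "single s = (\<lambda>t. if t = s then 1 else 0)"

definition quotient_vs ::
    "(complex, 'a, 'n) module_scheme \<Rightarrow> 'a set \<Rightarrow> (complex, 'a set) module"
  where "quotient_vs M H =
    \<lparr>carrier = a_rcosets\<^bsub>M\<^esub> H,
     mult = undefined,
     one = undefined,
     zero = H,
     add = set_add M,
     smult = (\<lambda>c A. \<Union>x\<in>A. H +>\<^bsub>M\<^esub> (c \<odot>\<^bsub>M\<^esub> x))\<rparr>"

text \<open>
  The tensor product of a finite family is the quotient of the free vector space on all tuples
  by the subspace that the multilinearity relations span.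
\<close>

abbreviation tuples :: "'i set \<Rightarrow> ('i \<Rightarrow> (complex, 'u, 'n) module_scheme) \<Rightarrow> ('i \<Rightarrow> 'u) set"
  where "tuples I U \<equiv> (\<Pi>\<^sub>E i\<in>I. carrier (U i))"

definition tensor_relations ::
    "'i set \<Rightarrow> ('i \<Rightarrow> (complex, 'u, 'n) module_scheme) \<Rightarrow> (('i \<Rightarrow> 'u) \<Rightarrow> complex) set"
  where "tensor_relations I U =
    LinearCombinations.module.span \<complex> (free_vs (tuples I U))
      ({\<lambda>t. single (s(i := x \<oplus>\<^bsub>U i\<^esub> y)) t - single (s(i := x)) t - single (s(i := y)) t
          | s i x y. s \<in> tuples I U \<and> i \<in> I \<and> x \<in> carrier (U i) \<and> y \<in> carrier (U i)} \<union>
       {\<lambda>t. single (s(i := c \<odot>\<^bsub>U i\<^esub> x)) t - c * single (s(i := x)) t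
          | s i c x. s \<in> tuples I U \<and> i \<in> I \<and> x \<in> carrier (U i)})"

definition tensor_product ::
    "'i set \<Rightarrow> ('i \<Rightarrow> (complex, 'u, 'n) module_scheme) \<Rightarrow> (complex, (('i \<Rightarrow> 'u) \<Rightarrow> complex) set) module"
  where "tensor_product I U = quotient_vs (free_vs (tuples I U)) (tensor_relations I U)"

text \<open>
  An element \<open>X\<close> of the Lie algebra sends the class of a tuple \<open>s\<close> to the sum over \<open>i\<close> of the
  classes of the tuples in which \<open>s i\<close> is replaced by \<open>X s\<^sub>i\<close>.
\<close>

definition tensor_act ::
    "'i set \<Rightarrow> ('i \<Rightarrow> (complex, 'u, 'n) module_scheme) \<Rightarrow> ('i \<Rightarrow> 'g \<Rightarrow> 'u \<Rightarrow> 'u)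
      \<Rightarrow> 'g \<Rightarrow> (('i \<Rightarrow> 'u) \<Rightarrow> complex) set \<Rightarrow> (('i \<Rightarrow> 'u) \<Rightarrow> complex) set"
  where "tensor_act I U act X A =
    (\<Union>f\<in>A. tensor_relations I U +>\<^bsub>free_vs (tuples I U)\<^esub>
      (\<lambda>t. \<Sum>s | f s \<noteq> 0. \<Sum>i\<in>I. f s * single (s(i := act i X (s i))) t))"

end

theory Submission
  imports Defs
begin

text \<open>
  Evaluation of a Laurent polynomial at \<open>\<zeta> = z^(1/N)\<close> is a Lie algebra homomorphism from the twisted
  affine algebra to \<open>\<gg>\<close> that kills \<open>\<^bold>k\<close>, and \<open>U(z)\<close> is the pullback of \<open>U\<close> along it.  Replacing
  \<open>t^(k/N)\<close> by \<open>t^(k/N + m)\<close> multiplies the action on the \<open>i\<close>-th tensor factor by \<open>z\<^sub>i^m\<close>.  Hence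
  multiplying \<open>a(x)\<close> by \<open>p(x)\<close> multiplies the contribution of the \<open>i\<close>-th factor by \<open>p(z\<^sub>i)\<close>, which
  vanishes for \<open>p = (x - z\<^sub>1)\<cdots>(x - z\<^sub>r)\<close>.

  On the tensor product everything is computed in the free space on tuples, modulo the span of the
  multilinearity relations.
\<close>

section \<open>Quotients and free vector spaces\<close>

text \<open>The coefficients of \<open>current\<close> rest on a definite description in
  \<open>component\<close>, so nothing is known about them before existence and uniqueness of the
  eigenspace decomposition are proved. Averages of the powers of \<sigma>, weighted by powers of
  \<epsilon>, give both through orthogonality of the characters of a cyclic group.
  \<open>category_E\<close> asks for a module over an actual Lie algebra, so the axioms of
  \<open>twisted_affine\<close> have to be verified as well. Its bracket is a sum over a support,
  which can shrink under addition; summing over larger finite sets restores additivity, and most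
  identities are then checked on homogeneous elements. Scaling in a quotient and
  \<open>tensor_act\<close> are unions over all representatives of a class, and have a usable value
  only once all representatives are known to give the same coset. In the free space a tuple with a
  sum in one entry is unrelated to the tuples with the summands. The action is therefore not linear
  in the Lie algebra element there; it is so up to an explicit sum of relations.\<close>

lemma vectorspace_complexI:
  fixes V :: "(complex, 'v, 'n) module_scheme" (structure)
  assumes "\<zero> \<in> carrier V"
    and "\<And>x y. \<lbrakk>x \<in> carrier V; y \<in> carrier V\<rbrakk> \<Longrightarrow> x \<oplus> y \<in> carrier V"
    and "\<And>c x. x \<in> carrier V \<Longrightarrow> c \<odot> x \<in> carrier V"
    and "\<And>x y. \<lbrakk>x \<in> carrier V; y \<in> carrier V\<rbrakk> \<Longrightarrow> x \<oplus> y = y \<oplus> x"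
    and "\<And>x y w. \<lbrakk>x \<in> carrier V; y \<in> carrier V; w \<in> carrier V\<rbrakk>
      \<Longrightarrow> (x \<oplus> y) \<oplus> w = x \<oplus> (y \<oplus> w)"
    and "\<And>x. x \<in> carrier V \<Longrightarrow> x \<oplus> \<zero> = x"
    and "\<And>x. x \<in> carrier V \<Longrightarrow> 0 \<odot> x = \<zero>"
    and "\<And>x. x \<in> carrier V \<Longrightarrow> 1 \<odot> x = x"
    and "\<And>c d x. x \<in> carrier V \<Longrightarrow> (c * d) \<odot> x = c \<odot> (d \<odot> x)"
    and "\<And>c d x. x \<in> carrier V \<Longrightarrow> (c + d) \<odot> x = c \<odot> x \<oplus> d \<odot> x"
    and "\<And>c x y. \<lbrakk>x \<in> carrier V; y \<in> carrier V\<rbrakk> \<Longrightarrow> c \<odot> (x \<oplus> y) = c \<odot> x \<oplus> c \<odot> y"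
  shows "vectorspace \<complex> V"
proof -
  \<comment> \<open>Additive inverses come from the scalar -1, because 1 + (-1) = 0 acts as
    zero.\<close>
  have "\<exists>y\<in>carrier V. x \<oplus> y = \<zero>" if "x \<in> carrier V" for x
  proof
    show "(-1) \<odot> x \<in> carrier V" using that assms by simp
    have "x \<oplus> (-1) \<odot> x = (1 + - 1) \<odot> x" using that assms by metis
    then show "x \<oplus> (-1) \<odot> x = \<zero>" using that assms by simp
  qed
  then show ?thesis
    using assms by (intro vs_criteria class_field) auto
qed

lemma uminus_eq_smult:
  fixes V :: "(complex, 'v, 'n) module_scheme"
  shows "vectorspace \<complex> V \<Longrightarrow> x \<in> carrier V \<Longrightarrow> \<ominus>\<^bsub>V\<^esub> x = (-1) \<odot>\<^bsub>V\<^esub> x"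
proof -
  assume "vectorspace \<complex> V" "x \<in> carrier V"
  interpret vectorspace \<complex> V by fact
  show ?thesis using smult_minus_1[OF \<open>x \<in> carrier V\<close>] by (simp add: class_ring_simps)
qed

section \<open>Quotient of a complex vector space by a subspace\<close>

locale quotient_space = vectorspace \<complex> V
  for V :: "(complex, 'v, 'n) module_scheme" (structure) +
  fixes H :: "'v set"
  assumes sub: "submodule \<complex> H V"
begin

lemma H_subset: "H \<subseteq> carrier V" and H_add: "\<lbrakk>x \<in> H; y \<in> H\<rbrakk> \<Longrightarrow> x \<oplus> y \<in> H"
  and H_zero: "\<zero> \<in> H" and H_smult: "x \<in> H \<Longrightarrow> c \<odot> x \<in> H"
  using sub by (auto simp: submodule_def)

lemma H_neg: "x \<in> H \<Longrightarrow> \<ominus> x \<in> H"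
  using H_smult H_subset uminus_eq_smult[OF vectorspace_axioms] by auto

lemma subgroup_H: "subgroup H (add_monoid V)"
  using H_subset H_add H_zero H_neg
  by (intro group.subgroupI[OF add.is_group]) (auto simp flip: a_inv_def)

sublocale abelian_subgroup H V
  by (intro abelian_subgroupI3 additive_subgroupI subgroup_H) unfold_locales

abbreviation cls :: "'v \<Rightarrow> 'v set"
  where "cls x \<equiv> H +> x"

abbreviation Q :: "(complex, 'v set) module"
  where "Q \<equiv> quotient_vs V H"

lemma mem_cls_iff: "\<lbrakk>x \<in> carrier V\<rbrakk> \<Longrightarrow> y \<in> cls x \<longleftrightarrow> y \<in> carrier V \<and> y \<ominus> x \<in> H"
proof -
  assume x: "x \<in> carrier V"
  show ?thesis
  proof
    assume "y \<in> cls x"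
    then obtain h where "h \<in> H" "y = h \<oplus> x" by (auto simp: a_r_coset_def')
    moreover have "h \<in> carrier V" using \<open>h \<in> H\<close> H_subset by auto
    ultimately show "y \<in> carrier V \<and> y \<ominus> x \<in> H"
      using x by (simp add: a_minus_def a_assoc r_neg)
  next
    assume "y \<in> carrier V \<and> y \<ominus> x \<in> H"
    moreover from this have "y = (y \<ominus> x) \<oplus> x" using x by (simp add: a_minus_def a_assoc l_neg)
    ultimately show "y \<in> cls x" by (auto simp: a_r_coset_def')
  qed
qed

lemma cls_eq_iff: "\<lbrakk>x \<in> carrier V; y \<in> carrier V\<rbrakk> \<Longrightarrow> cls x = cls y \<longleftrightarrow> x \<ominus> y \<in> H"
  using mem_cls_iff a_rcos_self a_repr_independence subgroup_H by metis

lemma carrier_Q: "carrier Q = cls ` carrier V"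
  by (auto simp: quotient_vs_def A_RCOSETS_def')

lemma cls_add: "\<lbrakk>x \<in> carrier V; y \<in> carrier V\<rbrakk> \<Longrightarrow> cls x \<oplus>\<^bsub>Q\<^esub> cls y = cls (x \<oplus> y)"
  by (simp add: quotient_vs_def a_rcos_sum)

lemma cls_zero: "\<zero>\<^bsub>Q\<^esub> = cls \<zero>"
  using H_subset by (simp add: quotient_vs_def)

text \<open>This evaluates the definitions that take a union over representatives. If
  \<open>D\<close> respects congruence modulo \<open>H\<close>, every member of the union is the
  same coset, and the union is not empty because \<open>x\<close> is a representative of its own
  class.\<close>

lemma UN_cls:
  assumes x: "x \<in> carrier V" and D: "\<And>y. y \<in> carrier V \<Longrightarrow> D y \<in> carrier V"
    and "\<And>y. \<lbrakk>y \<in> carrier V; y \<ominus> x \<in> H\<rbrakk> \<Longrightarrow> D y \<ominus> D x \<in> H"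
  shows "(\<Union>y\<in>cls x. cls (D y)) = cls (D x)"
proof -
  have "cls (D y) = cls (D x)" if "y \<in> cls x" for y
    using that assms mem_cls_iff[OF x] cls_eq_iff by simp
  then show ?thesis by (intro UN_constant_eq[OF a_rcos_self[OF x]] ballI)
qed

lemma cls_smult:
  assumes x: "x \<in> carrier V"
  shows "c \<odot>\<^bsub>Q\<^esub> cls x = cls (c \<odot> x)"
proof -
  have "c \<odot> y \<ominus> c \<odot> x = c \<odot> (y \<ominus> x)" if "y \<in> carrier V" for y
    using x that by (simp add: a_minus_def smult_r_distr smult_r_minus)
  then show ?thesis
    using x H_smult UN_cls[of x "\<lambda>y. c \<odot> y"] by (simp add: quotient_vs_def)
qed

lemma vectorspace_Q: "vectorspace \<complex> Q"
proof (rule vectorspace_complexI)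
  fix A B C :: "'v set" and c d :: complex
  assume "A \<in> carrier Q"
  then obtain x where x: "x \<in> carrier V" "A = cls x" by (auto simp: carrier_Q)
  then show "c \<odot>\<^bsub>Q\<^esub> A \<in> carrier Q" "A \<oplus>\<^bsub>Q\<^esub> \<zero>\<^bsub>Q\<^esub> = A"
    "0 \<odot>\<^bsub>Q\<^esub> A = \<zero>\<^bsub>Q\<^esub>" "1 \<odot>\<^bsub>Q\<^esub> A = A"
    using smult_l_null[of x] smult_one[of x] by (simp_all add: cls_smult carrier_Q cls_zero cls_add)
  show "(c * d) \<odot>\<^bsub>Q\<^esub> A = c \<odot>\<^bsub>Q\<^esub> (d \<odot>\<^bsub>Q\<^esub> A)"
    using x smult_assoc1[of c d x] by (simp add: cls_smult)
  show "(c + d) \<odot>\<^bsub>Q\<^esub> A = c \<odot>\<^bsub>Q\<^esub> A \<oplus>\<^bsub>Q\<^esub> d \<odot>\<^bsub>Q\<^esub> A"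
    using x smult_l_distr[of c d x] by (simp add: cls_smult cls_add)
  assume "B \<in> carrier Q"
  then obtain y where y: "y \<in> carrier V" "B = cls y" by (auto simp: carrier_Q)
  show "A \<oplus>\<^bsub>Q\<^esub> B \<in> carrier Q" "A \<oplus>\<^bsub>Q\<^esub> B = B \<oplus>\<^bsub>Q\<^esub> A"
    using x y a_comm[of x y] by (simp_all add: cls_add carrier_Q)
  show "c \<odot>\<^bsub>Q\<^esub> (A \<oplus>\<^bsub>Q\<^esub> B) = c \<odot>\<^bsub>Q\<^esub> A \<oplus>\<^bsub>Q\<^esub> c \<odot>\<^bsub>Q\<^esub> B"
    using x y smult_r_distr[of c x y] by (simp add: cls_smult cls_add)
  assume "C \<in> carrier Q"
  then obtain w where w: "w \<in> carrier V" "C = cls w" by (auto simp: carrier_Q)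
  show "(A \<oplus>\<^bsub>Q\<^esub> B) \<oplus>\<^bsub>Q\<^esub> C = A \<oplus>\<^bsub>Q\<^esub> (B \<oplus>\<^bsub>Q\<^esub> C)"
    using x y w a_assoc[of x y w] by (simp add: cls_add)
next
  show "\<zero>\<^bsub>Q\<^esub> \<in> carrier Q" by (auto simp: cls_zero carrier_Q)
qed

end

section \<open>Free vector spaces and maps given on a basis\<close>

text \<open>Linear extension from the basis; meaningful only for \<open>f\<close> of finite support.\<close>

definition lext :: "('s \<Rightarrow> 't \<Rightarrow> complex) \<Rightarrow> ('s \<Rightarrow> complex) \<Rightarrow> 't \<Rightarrow> complex"
  where "lext \<phi> f = (\<lambda>t. \<Sum>s | f s \<noteq> 0. f s * \<phi> s t)"

abbreviation finsupp :: "('s \<Rightarrow> complex) \<Rightarrow> bool"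
  where "finsupp f \<equiv> finite {s. f s \<noteq> 0}"

lemma lext_superset:
  "\<lbrakk>finite A; {s. f s \<noteq> 0} \<subseteq> A\<rbrakk> \<Longrightarrow> lext \<phi> f t = (\<Sum>s\<in>A. f s * \<phi> s t)"
  unfolding lext_def by (intro sum.mono_neutral_left) auto

lemma lext_add:
  assumes "finsupp f" "finsupp g"
  shows "lext \<phi> (\<lambda>s. f s + g s) = (\<lambda>t. lext \<phi> f t + lext \<phi> g t)"
proof
  fix t
  let ?A = "{s. f s \<noteq> 0} \<union> {s. g s \<noteq> 0}"
  have "lext \<phi> (\<lambda>s. f s + g s) t = (\<Sum>s\<in>?A. (f s + g s) * \<phi> s t)"
    and "lext \<phi> f t = (\<Sum>s\<in>?A. f s * \<phi> s t)" and "lext \<phi> g t = (\<Sum>s\<in>?A. g s * \<phi> s t)"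
    using assms by (auto intro!: lext_superset)
  then show "lext \<phi> (\<lambda>s. f s + g s) t = lext \<phi> f t + lext \<phi> g t"
    by (simp add: sum.distrib algebra_simps)
qed

lemma lext_smult: "lext \<phi> (\<lambda>s. c * f s) = (\<lambda>t. c * lext \<phi> f t)"
  \<comment> \<open>For c = 0 the support of the scaled function collapses to the empty set;
    otherwise it is the support of \<open>f\<close>.\<close>
  by (cases "c = 0") (auto simp: lext_def sum_distrib_left mult.assoc)

lemma lext_zero: "lext \<phi> (\<lambda>s. 0) = (\<lambda>t. 0)"
  by (simp add: lext_def)

lemma lext_single: "lext \<phi> (single s) = \<phi> s"
  by (simp add: lext_def single_def)

lemma finsupp_single: "finsupp (single s)"
  by (simp add: single_def)

lemma finsupp_add: "\<lbrakk>finsupp f; finsupp g\<rbrakk> \<Longrightarrow> finsupp (\<lambda>s. f s + g s)"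
  by (rule finite_subset[of _ "{s. f s \<noteq> 0} \<union> {s. g s \<noteq> 0}"]) auto

lemma finsupp_smult: "finsupp f \<Longrightarrow> finsupp (\<lambda>s. c * f s)"
  by (rule finite_subset[of _ "{s. f s \<noteq> 0}"]) auto

lemma lext_sum_arg:
  assumes "finite A" "\<And>i. i \<in> A \<Longrightarrow> finsupp (g i)"
  shows "finsupp (\<lambda>s. \<Sum>i\<in>A. g i s) \<and> lext \<phi> (\<lambda>s. \<Sum>i\<in>A. g i s) = (\<lambda>t. \<Sum>i\<in>A. lext \<phi> (g i) t)"
  using assms
proof (induction A rule: finite_induct)
  case (insert i A)
  then show ?case
    using finsupp_add[of "g i" "\<lambda>s. \<Sum>i\<in>A. g i s"] lext_add[of "g i" "\<lambda>s. \<Sum>i\<in>A. g i s" \<phi>] by auto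
qed (simp add: lext_zero)

text \<open>A composite of linear extensions is again determined by its values on the basis. Finite
  support of \<open>f\<close> and of each relevant \<psi> s allows the outer extension to pass
  through the sum.\<close>

lemma lext_lext:
  assumes "finsupp f" "\<And>s. f s \<noteq> 0 \<Longrightarrow> finsupp (\<psi> s)"
  shows "lext \<phi> (lext \<psi> f) = lext (\<lambda>s. lext \<phi> (\<psi> s)) f"
proof -
  have "lext \<phi> (\<lambda>t. \<Sum>s | f s \<noteq> 0. f s * \<psi> s t) = (\<lambda>t. \<Sum>s | f s \<noteq> 0. lext \<phi> (\<lambda>t. f s * \<psi> s t) t)"
    using assms lext_sum_arg[of "{s. f s \<noteq> 0}" "\<lambda>s t. f s * \<psi> s t" \<phi>] finsupp_smult by auto
  then show ?thesis by (simp add: lext_smult) (simp add: lext_def)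
qed

lemma vectorspace_free_vs: "vectorspace \<complex> (free_vs S)"
proof (rule vectorspace_complexI)
  fix x y assume "x \<in> carrier (free_vs S)" "y \<in> carrier (free_vs S)"
  then show "x \<oplus>\<^bsub>free_vs S\<^esub> y \<in> carrier (free_vs S)"
    by (auto simp: free_vs_def finsupp_add)
next
  fix x c assume "x \<in> carrier (free_vs S)"
  then show "c \<odot>\<^bsub>free_vs S\<^esub> x \<in> carrier (free_vs S)"
    by (auto simp: free_vs_def finsupp_smult)
qed (auto simp: free_vs_def algebra_simps)

lemma
  shows zero_free_vs: "\<zero>\<^bsub>free_vs S\<^esub> = (\<lambda>_. 0)"
    and add_free_vs: "f \<oplus>\<^bsub>free_vs S\<^esub> g = (\<lambda>s. f s + g s)"
    and smult_free_vs: "c \<odot>\<^bsub>free_vs S\<^esub> f = (\<lambda>s. c * f s)"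
  by (simp_all add: free_vs_def)

lemma minus_free_vs:
  assumes "g \<in> carrier (free_vs S)"
  shows "f \<ominus>\<^bsub>free_vs S\<^esub> g = (\<lambda>s. f s - g s)"
proof -
  interpret vectorspace \<complex> "free_vs S" by (rule vectorspace_free_vs)
  have "\<ominus>\<^bsub>free_vs S\<^esub> g = (\<lambda>s. - g s)"
    using smult_minus_1[OF assms] by (simp add: class_ring_simps smult_free_vs)
  then show ?thesis by (simp add: a_minus_def add_free_vs)
qed

lemma single_in_free_vs: "s \<in> S \<Longrightarrow> single s \<in> carrier (free_vs S)"
  by (auto simp: free_vs_def single_def)

lemma finsupp_free_vs: "f \<in> carrier (free_vs S) \<Longrightarrow> finsupp f"
  and support_free_vs: "\<lbrakk>f \<in> carrier (free_vs S); f s \<noteq> 0\<rbrakk> \<Longrightarrow> s \<in> S"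
  by (auto simp: free_vs_def)

section \<open>Tensor products\<close>

text \<open>An infinite index set is covered too: its sum is 0 by convention, and 0 lies in every
  submodule.\<close>

lemma submodule_sum_closed:
  assumes "submodule \<complex> H (free_vs S)" "\<And>i. i \<in> A \<Longrightarrow> g i \<in> H"
  shows "(\<lambda>t. \<Sum>i\<in>A. g i t) \<in> H"
  using assms(2)
proof (induction A rule: infinite_finite_induct)
  case (insert i A)
  then show ?case using assms(1) by (auto simp: submodule_def add_free_vs)
qed (use assms(1) in \<open>auto simp: submodule_def zero_free_vs\<close>)

lemma submodule_lext_closed:
  assumes "submodule \<complex> H (free_vs S)" "\<And>s. f s \<noteq> 0 \<Longrightarrow> \<phi> s \<in> H"
  shows "lext \<phi> f \<in> H"
  unfolding lext_def
proof (rule submodule_sum_closed[OF assms(1)])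
  fix s assume "s \<in> {s. f s \<noteq> 0}"
  then have "\<phi> s \<in> H" using assms(2) by simp
  then show "(\<lambda>t. f s * \<phi> s t) \<in> H"
    using assms(1) unfolding submodule_def smult_free_vs by fastforce
qed

text \<open>The action of one Lie algebra element on a pure tensor, lifted to the free space.
  \<open>tensor_act\<close> is the linear extension of this map, read modulo the relations.\<close>

definition leibniz :: "'i set \<Rightarrow> ('i \<Rightarrow> 'u \<Rightarrow> 'u) \<Rightarrow> ('i \<Rightarrow> 'u) \<Rightarrow> ('i \<Rightarrow> 'u) \<Rightarrow> complex"
  where "leibniz I a s = (\<lambda>t. \<Sum>i\<in>I. single (s(i := a i (s i))) t)"

section \<open>The subspace of multilinearity relations\<close>

locale tensor =
  fixes I :: "'i set" and U :: "'i \<Rightarrow> (complex, 'u, 'n) module_scheme"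
  assumes fin_I: "finite I" and vs_U: "\<And>i. i \<in> I \<Longrightarrow> vectorspace \<complex> (U i)"
begin

abbreviation F :: "(complex, ('i \<Rightarrow> 'u) \<Rightarrow> complex) module"
  where "F \<equiv> free_vs (tuples I U)"

abbreviation R :: "(('i \<Rightarrow> 'u) \<Rightarrow> complex) set"
  where "R \<equiv> tensor_relations I U"

definition add_rel :: "('i \<Rightarrow> 'u) \<Rightarrow> 'i \<Rightarrow> 'u \<Rightarrow> 'u \<Rightarrow> ('i \<Rightarrow> 'u) \<Rightarrow> complex"
  where "add_rel s i x y =
    (\<lambda>t. single (s(i := x \<oplus>\<^bsub>U i\<^esub> y)) t - single (s(i := x)) t - single (s(i := y)) t)"

definition smult_rel :: "('i \<Rightarrow> 'u) \<Rightarrow> 'i \<Rightarrow> complex \<Rightarrow> 'u \<Rightarrow> ('i \<Rightarrow> 'u) \<Rightarrow> complex"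
  where "smult_rel s i c x = (\<lambda>t. single (s(i := c \<odot>\<^bsub>U i\<^esub> x)) t - c * single (s(i := x)) t)"

definition rels :: "(('i \<Rightarrow> 'u) \<Rightarrow> complex) set"
  where "rels = {add_rel s i x y | s i x y.
      s \<in> tuples I U \<and> i \<in> I \<and> x \<in> carrier (U i) \<and> y \<in> carrier (U i)} \<union>
    {smult_rel s i c x | s i c x. s \<in> tuples I U \<and> i \<in> I \<and> x \<in> carrier (U i)}"

lemma R_eq: "R = LinearCombinations.module.span \<complex> F rels"
  by (simp add: tensor_relations_def rels_def add_rel_def smult_rel_def)

sublocale F: vectorspace \<complex> F
  by (rule vectorspace_free_vs)

lemma upd_tuple: "\<lbrakk>s \<in> tuples I U; i \<in> I; x \<in> carrier (U i)\<rbrakk> \<Longrightarrow> s(i := x) \<in> tuples I U"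
  by (auto simp: PiE_iff extensional_def)

lemma U_add: "\<lbrakk>i \<in> I; x \<in> carrier (U i); y \<in> carrier (U i)\<rbrakk> \<Longrightarrow> x \<oplus>\<^bsub>U i\<^esub> y \<in> carrier (U i)"
  and U_smult: "\<lbrakk>i \<in> I; x \<in> carrier (U i)\<rbrakk> \<Longrightarrow> c \<odot>\<^bsub>U i\<^esub> x \<in> carrier (U i)"
proof -
  assume i: "i \<in> I"
  then interpret vectorspace \<complex> "U i" by (rule vs_U)
  show "\<lbrakk>x \<in> carrier (U i); y \<in> carrier (U i)\<rbrakk> \<Longrightarrow> x \<oplus>\<^bsub>U i\<^esub> y \<in> carrier (U i)"
   and "x \<in> carrier (U i) \<Longrightarrow> c \<odot>\<^bsub>U i\<^esub> x \<in> carrier (U i)" by auto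
qed

lemma F_diff: "\<lbrakk>f \<in> carrier F; g \<in> carrier F\<rbrakk> \<Longrightarrow> (\<lambda>t. f t - g t) \<in> carrier F"
  using F.minus_closed[of f g] by (simp add: minus_free_vs)

lemma F_mult: "f \<in> carrier F \<Longrightarrow> (\<lambda>t. c * f t) \<in> carrier F"
  using F.smult_closed[of c f] by (simp add: smult_free_vs)

lemma rels_F: "rels \<subseteq> carrier F"
  unfolding rels_def add_rel_def smult_rel_def
  by (auto intro!: F_diff F_mult single_in_free_vs upd_tuple U_add U_smult)

lemma submodule_F: "submodule \<complex> (carrier F) F"
  using vectorspace_free_vs[of "tuples I U"] by (auto simp: submodule_def vectorspace_def)

lemma sub_R: "submodule \<complex> R F"
  unfolding R_eq by (rule F.span_is_submodule[OF rels_F])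

lemma rels_R: "rels \<subseteq> R"
  unfolding R_eq by (rule F.in_own_span[OF rels_F])

lemma R_least: "\<lbrakk>rels \<subseteq> H; submodule \<complex> H F\<rbrakk> \<Longrightarrow> R \<subseteq> H"
  unfolding R_eq by (rule F.span_is_subset)

sublocale quotient_space F R
  by (intro quotient_space.intro quotient_space_axioms.intro vectorspace_free_vs sub_R)

lemma Q_eq: "quotient_vs F R = tensor_product I U"
  by (simp add: tensor_product_def)

lemma R_add: "\<lbrakk>f \<in> R; g \<in> R\<rbrakk> \<Longrightarrow> (\<lambda>t. f t + g t) \<in> R"
  using H_add[of f g] by (simp add: add_free_vs)

lemma R_smult: "f \<in> R \<Longrightarrow> (\<lambda>t. c * f t) \<in> R"
  using H_smult[of f c] by (simp add: smult_free_vs)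

lemmas R_sum = submodule_sum_closed[OF sub_R] and R_lext = submodule_lext_closed[OF sub_R]

lemma add_rel_R: "\<lbrakk>s \<in> tuples I U; i \<in> I; x \<in> carrier (U i); y \<in> carrier (U i)\<rbrakk>
    \<Longrightarrow> add_rel s i x y \<in> R"
  and smult_rel_R: "\<lbrakk>s \<in> tuples I U; i \<in> I; x \<in> carrier (U i)\<rbrakk> \<Longrightarrow> smult_rel s i c x \<in> R"
  by (rule subsetD[OF rels_R], unfold rels_def, blast)+

lemma cls_eq: "\<lbrakk>f \<in> carrier F; g \<in> carrier F\<rbrakk> \<Longrightarrow> cls f = cls g \<longleftrightarrow> (\<lambda>t. f t - g t) \<in> R"
  by (simp add: cls_eq_iff minus_free_vs)

end

section \<open>Leibniz operators descend to the tensor product\<close>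

locale tensor_operator = tensor I U
  for I :: "'i set" and U :: "'i \<Rightarrow> (complex, 'u, 'n) module_scheme" +
  fixes act :: "'i \<Rightarrow> 'u \<Rightarrow> 'u"
  assumes act_closed: "\<lbrakk>i \<in> I; x \<in> carrier (U i)\<rbrakk> \<Longrightarrow> act i x \<in> carrier (U i)"
    and act_add: "\<lbrakk>i \<in> I; x \<in> carrier (U i); y \<in> carrier (U i)\<rbrakk>
      \<Longrightarrow> act i (x \<oplus>\<^bsub>U i\<^esub> y) = act i x \<oplus>\<^bsub>U i\<^esub> act i y"
    and act_smult: "\<lbrakk>i \<in> I; x \<in> carrier (U i)\<rbrakk> \<Longrightarrow> act i (c \<odot>\<^bsub>U i\<^esub> x) = c \<odot>\<^bsub>U i\<^esub> act i x"
begin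

abbreviation der :: "('i \<Rightarrow> 'u) \<Rightarrow> ('i \<Rightarrow> 'u) \<Rightarrow> complex"
  where "der \<equiv> leibniz I act"

lemma act_tuple: "\<lbrakk>s \<in> tuples I U; i \<in> I\<rbrakk> \<Longrightarrow> s(i := act i (s i)) \<in> tuples I U"
  by (intro upd_tuple act_closed) auto

lemma der_F: "s \<in> tuples I U \<Longrightarrow> der s \<in> carrier F"
  unfolding leibniz_def
  by (intro submodule_sum_closed[OF submodule_F] single_in_free_vs act_tuple)

lemma lext_der_F: "f \<in> carrier F \<Longrightarrow> lext der f \<in> carrier F"
  by (rule submodule_lext_closed[OF submodule_F]) (auto intro: der_F dest: support_free_vs)

lemma lext_diff:
  assumes "f \<in> carrier F" "g \<in> carrier F"
  shows "lext \<phi> (\<lambda>t. f t - g t) = (\<lambda>t. lext \<phi> f t - lext \<phi> g t)"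
  using assms lext_add[of f "\<lambda>t. -1 * g t" \<phi>] lext_smult[of \<phi> "-1" g]
    finsupp_smult[of g "-1"] finsupp_free_vs[OF assms(1)] finsupp_free_vs[OF assms(2)] by simp

text \<open>The Leibniz sum of an additivity relation is again a sum of additivity relations, one
  for each slot \<open>j\<close>. For \<open>j = i\<close> the operator is additive on the slot
  under test, so it turns \<open>x\<close> and \<open>y\<close> into their images. For any other
  \<open>j\<close> it changes an unrelated entry of \<open>s\<close> and leaves the relation in slot
  \<open>i\<close> intact.\<close>

lemma der_upd_add:
  assumes s: "s \<in> tuples I U" and i: "i \<in> I" and x: "x \<in> carrier (U i)" and y: "y \<in> carrier (U i)"
  shows "lext der (add_rel s i x y) \<in> R"
proof -
  let ?x = "s(i := x)" and ?y = "s(i := y)" and ?z = "s(i := x \<oplus>\<^bsub>U i\<^esub> y)"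
  have tup: "?x \<in> tuples I U" "?y \<in> tuples I U" "?z \<in> tuples I U"
    using assms by (auto intro!: upd_tuple U_add)
  have "lext der (add_rel s i x y) = (\<lambda>t. der ?z t - der ?x t - der ?y t)"
    unfolding add_rel_def using tup
    by (simp add: lext_diff F_diff single_in_free_vs lext_single)
  also have "\<dots> = (\<lambda>t. \<Sum>j\<in>I. single (?z(j := act j (?z j))) t
      - single (?x(j := act j (?x j))) t - single (?y(j := act j (?y j))) t)"
    by (simp add: leibniz_def sum_subtractf)
  also have "\<dots> = (\<lambda>t. \<Sum>j\<in>I. (if j = i then add_rel s i (act i x) (act i y)
      else add_rel (s(j := act j (s j))) i x y) t)"
    using assms by (intro ext sum.cong) (auto simp: add_rel_def act_add fun_upd_twist)
  also have "\<dots> \<in> R"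
    using assms by (intro R_sum) (auto intro!: add_rel_R act_closed act_tuple)
  finally show ?thesis .
qed

lemma der_upd_smult:
  assumes s: "s \<in> tuples I U" and i: "i \<in> I" and x: "x \<in> carrier (U i)"
  shows "lext der (smult_rel s i c x) \<in> R"
proof -
  let ?x = "s(i := x)" and ?z = "s(i := c \<odot>\<^bsub>U i\<^esub> x)"
  have tup: "?x \<in> tuples I U" "?z \<in> tuples I U"
    using assms by (auto intro!: upd_tuple U_smult)
  have "lext der (smult_rel s i c x) = (\<lambda>t. der ?z t - c * der ?x t)"
    unfolding smult_rel_def using tup
    by (simp add: lext_diff F_mult single_in_free_vs lext_single lext_smult)
  also have "\<dots> = (\<lambda>t. \<Sum>j\<in>I. single (?z(j := act j (?z j))) t
      - c * single (?x(j := act j (?x j))) t)"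
    by (simp add: leibniz_def sum_subtractf sum_distrib_left)
  also have "\<dots> = (\<lambda>t. \<Sum>j\<in>I. (if j = i then smult_rel s i c (act i x)
      else smult_rel (s(j := act j (s j))) i c x) t)"
    using assms by (intro ext sum.cong) (auto simp: smult_rel_def act_smult fun_upd_twist)
  also have "\<dots> \<in> R"
    using assms by (intro R_sum) (auto intro!: smult_rel_R act_closed act_tuple)
  finally show ?thesis .
qed

lemma lext_der_R: "f \<in> R \<Longrightarrow> lext der f \<in> R"
proof -
  \<comment> \<open>The preimage of \<open>R\<close> under the operator is a subspace, so it
    contains the span \<open>R\<close> as soon as it contains the generators.\<close>
  let ?H = "{f \<in> carrier F. lext der f \<in> R}"
  have "submodule \<complex> ?H F"
    unfolding submodule_def
    using vectorspace_free_vs[of "tuples I U", unfolded vectorspace_def] H_zero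
    by (auto simp: zero_free_vs add_free_vs smult_free_vs lext_zero lext_smult lext_add
        finsupp_free_vs
        intro!: R_add R_smult F_mult F.M.add.m_closed[unfolded add_free_vs, simplified])
  moreover have "rels \<subseteq> ?H"
  proof
    fix f assume f: "f \<in> rels"
    then have "lext der f \<in> R"
      unfolding rels_def using der_upd_add der_upd_smult by blast
    then show "f \<in> ?H" using f rels_F by auto
  qed
  ultimately show "f \<in> R \<Longrightarrow> lext der f \<in> R"
    using R_least[of ?H] by auto
qed

lemma UN_cls_der:
  assumes "f \<in> carrier F"
  shows "(\<Union>g\<in>cls f. cls (lext der g)) = cls (lext der f)"
  using assms lext_der_F
  by (intro UN_cls) (auto simp: minus_free_vs lext_diff[symmetric] intro!: lext_der_R)

end

lemma (in quotient_space) cls_minus: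
  "\<lbrakk>x \<in> carrier V; y \<in> carrier V\<rbrakk> \<Longrightarrow> cls x \<ominus>\<^bsub>Q\<^esub> cls y = cls (x \<ominus> y)"
  using uminus_eq_smult[OF vectorspace_Q, of "cls y"] uminus_eq_smult[OF vectorspace_axioms, of y]
  by (simp add: a_minus_def cls_smult cls_add carrier_Q)

lemma (in quotient_space) finsum_cls:
  assumes "finite A" "\<And>i. i \<in> A \<Longrightarrow> g i \<in> carrier V"
  shows "(\<Oplus>\<^bsub>Q\<^esub>i\<in>A. c i \<odot>\<^bsub>Q\<^esub> cls (g i)) = cls (\<Oplus>i\<in>A. c i \<odot> g i)"
  using assms
proof (induction A rule: finite_induct)
  case empty
  interpret Q: vectorspace \<complex> Q by (rule vectorspace_Q)
  show ?case by (simp add: cls_zero)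
next
  case (insert i A)
  interpret Q: vectorspace \<complex> Q by (rule vectorspace_Q)
  from insert show ?case
    by (subst Q.finsum_insert; (subst finsum_insert)?)
      (auto simp: cls_smult cls_add carrier_Q Pi_iff)
qed

lemma finsum_free_vs:
  assumes "finite A" "\<And>i. i \<in> A \<Longrightarrow> g i \<in> carrier (free_vs S)"
  shows "(\<Oplus>\<^bsub>free_vs S\<^esub>i\<in>A. g i) = (\<lambda>t. \<Sum>i\<in>A. g i t)"
proof -
  interpret vectorspace \<complex> "free_vs S" by (rule vectorspace_free_vs)
  show ?thesis using assms
    by (induction A rule: finite_induct) (auto simp: zero_free_vs add_free_vs Pi_iff)
qed

section \<open>The tensor product as a module over a Lie algebra\<close>

locale tensor_lie_module = lie_algebra A
  for A :: "('g, 'm) lie_alg_scheme" (structure) +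
  fixes I :: "'i set" and U :: "'i \<Rightarrow> (complex, 'u, 'n) module_scheme"
    and act :: "'i \<Rightarrow> 'g \<Rightarrow> 'u \<Rightarrow> 'u"
  assumes finite_I: "finite I" and modules: "\<And>i. i \<in> I \<Longrightarrow> lie_module A (U i) (act i)"
begin

sublocale tensor I U
proof (intro tensor.intro finite_I)
  show "vectorspace \<complex> (U i)" if "i \<in> I" for i
    using modules[OF that] unfolding lie_module_def by blast
qed

lemma tensor_operator_act:
  assumes "X \<in> carrier A"
  shows "tensor_operator I U (\<lambda>i. act i X)"
proof (intro tensor_operator.intro tensor_axioms tensor_operator_axioms.intro)
  fix i assume "i \<in> I"
  then interpret lie_module A "U i" "act i" by (rule modules)
  show "\<And>x. x \<in> carrier (U i) \<Longrightarrow> act i X x \<in> carrier (U i)"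
    by (rule act_closed[OF assms])
  show "\<And>x y. \<lbrakk>x \<in> carrier (U i); y \<in> carrier (U i)\<rbrakk>
      \<Longrightarrow> act i X (x \<oplus>\<^bsub>U i\<^esub> y) = act i X x \<oplus>\<^bsub>U i\<^esub> act i X y"
    by (rule act_add_right[OF assms])
  show "\<And>x c. x \<in> carrier (U i) \<Longrightarrow> act i X (c \<odot>\<^bsub>U i\<^esub> x) = c \<odot>\<^bsub>U i\<^esub> act i X x"
    by (rule act_smult_right[OF assms])
qed

abbreviation der :: "'g \<Rightarrow> ('i \<Rightarrow> 'u) \<Rightarrow> ('i \<Rightarrow> 'u) \<Rightarrow> complex"
  where "der X \<equiv> leibniz I (\<lambda>i. act i X)"

lemma act_U: "\<lbrakk>X \<in> carrier A; i \<in> I; x \<in> carrier (U i)\<rbrakk> \<Longrightarrow> act i X x \<in> carrier (U i)"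
  using tensor_operator.act_closed[OF tensor_operator_act] .

lemma tensor_act_cls:
  assumes "X \<in> carrier A" "f \<in> carrier F"
  shows "tensor_act I U act X (cls f) = cls (lext (der X) f)"
  using tensor_operator.UN_cls_der[OF tensor_operator_act[OF assms(1)] assms(2)]
  by (simp add: tensor_act_def lext_def leibniz_def sum_distrib_left)

lemma der_F: "\<lbrakk>X \<in> carrier A; s \<in> tuples I U\<rbrakk> \<Longrightarrow> der X s \<in> carrier F"
  using tensor_operator.der_F[OF tensor_operator_act] .

lemma lext_der_F: "\<lbrakk>X \<in> carrier A; f \<in> carrier F\<rbrakk> \<Longrightarrow> lext (der X) f \<in> carrier F"
  using tensor_operator.lext_der_F[OF tensor_operator_act] .

lemma lext_R: "\<lbrakk>f \<in> carrier F; \<And>s. s \<in> tuples I U \<Longrightarrow> \<phi> s \<in> R\<rbrakk> \<Longrightarrow> lext \<phi> f \<in> R"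
  using R_lext support_free_vs by metis

text \<open>Basis vectors of the free space are not additive in the entries of a tuple. The defect
  consists of one additivity relation per factor, hence vanishes in the quotient.\<close>

lemma der_add:
  assumes "X \<in> carrier A" "Y \<in> carrier A" "s \<in> tuples I U"
  shows "(\<lambda>t. der (X \<oplus> Y) s t - (der X s t + der Y s t)) \<in> R"
proof -
  have "act i (X \<oplus> Y) (s i) = act i X (s i) \<oplus>\<^bsub>U i\<^esub> act i Y (s i)" if "i \<in> I" for i
    using lie_module.act_add_left[OF modules[OF that] assms(1,2)] that assms by auto
  then have "(\<lambda>t. der (X \<oplus> Y) s t - (der X s t + der Y s t)) =
      (\<lambda>t. \<Sum>i\<in>I. add_rel s i (act i X (s i)) (act i Y (s i)) t)"
    by (simp add: leibniz_def add_rel_def sum_subtractf algebra_simps cong: sum.cong)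
  also have "\<dots> \<in> R" using assms by (intro R_sum add_rel_R act_U) auto
  finally show ?thesis .
qed

lemma der_smult:
  assumes "X \<in> carrier A" "s \<in> tuples I U"
  shows "(\<lambda>t. der (c \<odot> X) s t - c * der X s t) \<in> R"
proof -
  have "act i (c \<odot> X) (s i) = c \<odot>\<^bsub>U i\<^esub> act i X (s i)" if "i \<in> I" for i
    using lie_module.act_smult_left[OF modules[OF that] assms(1)] that assms by auto
  then have "(\<lambda>t. der (c \<odot> X) s t - c * der X s t) = (\<lambda>t. \<Sum>i\<in>I. smult_rel s i c (act i X (s i)) t)"
    by (simp add: leibniz_def smult_rel_def sum_subtractf sum_distrib_left cong: sum.cong)
  also have "\<dots> \<in> R" using assms by (intro R_sum smult_rel_R act_U) auto
  finally show ?thesis .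
qed

lemma der_der: "lext (der X) (der Y s) = (\<lambda>t. \<Sum>i\<in>I. der X (s(i := act i Y (s i))) t)"
  using lext_sum_arg[OF finite_I, of "\<lambda>i. single (s(i := act i Y (s i)))" "der X"]
  by (simp add: leibniz_def[of I "\<lambda>i. act i Y"] finsupp_single lext_single)

lemma der_der_commutator:
  "lext (der X) (der Y s) t - lext (der Y) (der X s) t =
    (\<Sum>i\<in>I. single (s(i := act i X (act i Y (s i)))) t - single (s(i := act i Y (act i X (s i)))) t)"
proof -
  \<comment> \<open>\<open>G\<close> holds the terms in which the two elements act on different
    factors. Putting 0 on the diagonal lets both sums run over all of \<open>I\<close>, so that they
    can be interchanged.\<close>
  define G where "G X Y i j =
    (if i = j then 0 else single ((s(i := act i Y (s i)))(j := act j X (s j))) t)" for X Y i j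
  have *: "lext (der X) (der Y s) t
      = (\<Sum>i\<in>I. single (s(i := act i X (act i Y (s i)))) t) + (\<Sum>i\<in>I. \<Sum>j\<in>I. G X Y i j)"
    for X Y
  proof -
    have "der X (s(i := act i Y (s i))) t
        = single (s(i := act i X (act i Y (s i)))) t + (\<Sum>j\<in>I. G X Y i j)"
      if "i \<in> I" for i
    proof -
      have "der X (s(i := act i Y (s i))) t = (\<Sum>j\<in>I.
          (if j = i then single (s(i := act i X (act i Y (s i)))) t else 0) + G X Y i j)"
        unfolding leibniz_def by (intro sum.cong) (auto simp: G_def)
      then show ?thesis using that finite_I by (simp add: sum.distrib)
    qed
    then show ?thesis by (simp add: der_der sum.distrib)
  qed
  \<comment> \<open>The terms in which \<open>X\<close> and \<open>Y\<close> act on different factors cancel.\<close>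
  have "G X Y i j = G Y X j i" for i j
    by (auto simp: G_def fun_upd_twist)
  then have "(\<Sum>i\<in>I. \<Sum>j\<in>I. G X Y i j) = (\<Sum>i\<in>I. \<Sum>j\<in>I. G Y X i j)"
    by (subst sum.swap) simp
  then show ?thesis using *[of X Y] *[of Y X] by (simp add: sum_subtractf)
qed

text \<open>The commutator formula is exact in the free space and leaves a difference of two tuples
  per slot, whereas the bracket puts the difference of the two vectors inside the slot. An
  additivity relation separates these vectors, and a scaling relation with factor -1 takes the sign
  out.\<close>

lemma der_bracket:
  assumes X: "X \<in> carrier A" and Y: "Y \<in> carrier A" and s: "s \<in> tuples I U"
  shows "(\<lambda>t. der (bracket A X Y) s t - (lext (der X) (der Y s) t - lext (der Y) (der X s) t)) \<in> R"
proof -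
  let ?x = "\<lambda>i. act i X (act i Y (s i))" and ?y = "\<lambda>i. act i Y (act i X (s i))"
  have carr: "?x i \<in> carrier (U i)" "?y i \<in> carrier (U i)" if "i \<in> I" for i
    using that assms by (auto intro!: act_U)
  have neg: "(-1) \<odot>\<^bsub>U i\<^esub> ?y i \<in> carrier (U i)" if "i \<in> I" for i
    using carr that by (simp add: U_smult)
  have "act i (bracket A X Y) (s i) = ?x i \<oplus>\<^bsub>U i\<^esub> (-1) \<odot>\<^bsub>U i\<^esub> ?y i" if "i \<in> I" for i
  proof -
    have "s i \<in> carrier (U i)" using s that by auto
    from lie_module.act_bracket[OF modules[OF that] X Y this] show ?thesis
      using uminus_eq_smult[OF vs_U carr(2)] that by (simp add: a_minus_def)
  qed
  then have "(\<lambda>t. der (bracket A X Y) s t - (lext (der X) (der Y s) t - lext (der Y) (der X s) t))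
    = (\<lambda>t. \<Sum>i\<in>I. add_rel s i (?x i) ((-1) \<odot>\<^bsub>U i\<^esub> ?y i) t + smult_rel s i (-1) (?y i) t)"
    unfolding der_der_commutator
    by (simp add: leibniz_def add_rel_def smult_rel_def sum_subtractf sum.distrib algebra_simps
        cong: sum.cong)
  also have "\<dots> \<in> R" using s carr neg by (intro R_sum R_add smult_rel_R add_rel_R) auto
  finally show ?thesis .
qed

lemma lext_coeff_diff: "lext (\<lambda>s t. \<phi> s t - \<psi> s t) f = (\<lambda>t. lext \<phi> f t - lext \<psi> f t)"
  and lext_coeff_add: "lext (\<lambda>s t. \<phi> s t + \<psi> s t) f = (\<lambda>t. lext \<phi> f t + lext \<psi> f t)"
  and lext_coeff_smult: "lext (\<lambda>s t. c * \<phi> s t) f = (\<lambda>t. c * lext \<phi> f t)"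
  by (simp_all add: lext_def algebra_simps sum.distrib sum_subtractf sum_distrib_left)

lemma lie_module_tensor: "lie_module A (tensor_product I U) (tensor_act I U act)"
proof -
  interpret Q: vectorspace \<complex> Q by (rule vectorspace_Q)
  have closed: "tensor_act I U act X u \<in> carrier Q" if "X \<in> carrier A" "u \<in> carrier Q" for X u
    using that by (auto simp: carrier_Q tensor_act_cls lext_der_F)
  have "lie_module A Q (tensor_act I U act)"
  proof (intro lie_module.intro lie_algebra_axioms vectorspace_Q lie_module_axioms.intro closed)
    fix X Y u assume X: "X \<in> carrier A" and Y: "Y \<in> carrier A" and "u \<in> carrier Q"
    then obtain f where f: "f \<in> carrier F" and u: "u = cls f" by (auto simp: carrier_Q)
    note in_F = X Y f lext_der_F bracket_closed M.add.m_closed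
    have "lext (\<lambda>s t. der (X \<oplus> Y) s t - (der X s t + der Y s t)) f \<in> R"
      by (intro lext_R der_add f X Y)
    then show "tensor_act I U act (X \<oplus> Y) u = tensor_act I U act X u \<oplus>\<^bsub>Q\<^esub> tensor_act I U act Y u"
      using F.M.add.m_closed[of "lext (der X) f" "lext (der Y) f"]
      by (simp add: u in_F tensor_act_cls cls_add cls_eq lext_coeff_diff lext_coeff_add add_free_vs)
    have "lext (\<lambda>s t. der (bracket A X Y) s t - (lext (der X) (der Y s) t
        - lext (der Y) (der X s) t)) f \<in> R"
      by (intro lext_R der_bracket f X Y)
    \<comment> \<open>Acting twice on a class composes two linear extensions; this brings the
      composite back to tuples, where \<open>der_bracket\<close> applies.\<close>
    moreover have "lext (der X) (lext (der Y) f) = lext (\<lambda>s. lext (der X) (der Y s)) f"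
      "lext (der Y) (lext (der X) f) = lext (\<lambda>s. lext (der Y) (der X s)) f"
      using f X Y support_free_vs[OF f] der_F
      by (auto intro!: lext_lext finsupp_free_vs[of _ "tuples I U"])
    ultimately have "(\<lambda>t. lext (der (bracket A X Y)) f t -
        (lext (der X) (lext (der Y) f) t - lext (der Y) (lext (der X) f) t)) \<in> R"
      by (simp add: lext_coeff_diff)
    then show "tensor_act I U act (bracket A X Y) u =
        tensor_act I U act X (tensor_act I U act Y u)
          \<ominus>\<^bsub>Q\<^esub> tensor_act I U act Y (tensor_act I U act X u)"
      using F_diff
      by (simp add: u in_F tensor_act_cls cls_minus minus_free_vs cls_eq lext_coeff_diff)
  next
    fix X u c assume X: "X \<in> carrier A" and "u \<in> carrier Q"
    then obtain f where f: "f \<in> carrier F" and u: "u = cls f" by (auto simp: carrier_Q)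
    have "lext (\<lambda>s t. der (c \<odot> X) s t - c * der X s t) f \<in> R"
      by (intro lext_R der_smult f X)
    then show "tensor_act I U act (c \<odot> X) u = c \<odot>\<^bsub>Q\<^esub> tensor_act I U act X u"
      using X f
      by (simp add: u tensor_act_cls cls_smult lext_der_F cls_eq F_mult smult_free_vs
          lext_coeff_diff lext_coeff_smult)
    show "tensor_act I U act X (c \<odot>\<^bsub>Q\<^esub> u) = c \<odot>\<^bsub>Q\<^esub> tensor_act I U act X u"
      using X f by (simp add: u tensor_act_cls cls_smult lext_der_F smult_free_vs lext_smult F_mult)
  next
    fix X u v assume X: "X \<in> carrier A" and "u \<in> carrier Q" "v \<in> carrier Q"
    then obtain f g where f: "f \<in> carrier F" "u = cls f" and g: "g \<in> carrier F" "v = cls g"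
      by (auto simp: carrier_Q)
    then show "tensor_act I U act X (u \<oplus>\<^bsub>Q\<^esub> v) = tensor_act I U act X u \<oplus>\<^bsub>Q\<^esub> tensor_act I U act X v"
      using X F.M.add.m_closed[of f g]
      by (simp add: tensor_act_cls cls_add lext_der_F add_free_vs lext_add finsupp_free_vs)
  qed
  then show ?thesis by (simp add: Q_eq)
qed

text \<open>This is the form in which a coefficient of p(x) a(x) is tested: the combined operator is
  a linear extension, so sending every tuple into \<open>R\<close> forces it to send every
  representative of \<open>w\<close> into \<open>R\<close>.\<close>

lemma tensor_act_sum_eq_zero:
  assumes "finite M" "\<And>m. m \<in> M \<Longrightarrow> X m \<in> carrier A"
    and "\<And>s. s \<in> tuples I U \<Longrightarrow> (\<lambda>t. \<Sum>m\<in>M. c m * der (X m) s t) \<in> R"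
    and "w \<in> carrier (tensor_product I U)"
  shows "(\<Oplus>\<^bsub>tensor_product I U\<^esub>m\<in>M. c m \<odot>\<^bsub>tensor_product I U\<^esub> tensor_act I U act (X m) w)
      = \<zero>\<^bsub>tensor_product I U\<^esub>"
proof -
  obtain f where f: "f \<in> carrier F" and w: "w = cls f" using assms(4) carrier_Q by (auto simp: Q_eq)
  interpret Q: vectorspace \<complex> Q by (rule vectorspace_Q)
  have "lext (\<lambda>s t. \<Sum>m\<in>M. c m * der (X m) s t) f \<in> R"
    by (intro lext_R f assms)
  also have "lext (\<lambda>s t. \<Sum>m\<in>M. c m * der (X m) s t) f = (\<lambda>t. \<Sum>m\<in>M. c m * lext (der (X m)) f t)"
    by (simp add: lext_def sum_distrib_left sum.swap[of _ M] mult.left_commute)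
  also have "\<dots> = (\<Oplus>\<^bsub>F\<^esub>m\<in>M. c m \<odot>\<^bsub>F\<^esub> lext (der (X m)) f)"
    using assms f by (subst finsum_free_vs) (auto simp: smult_free_vs intro!: F_mult lext_der_F)
  finally have *: "(\<Oplus>\<^bsub>F\<^esub>m\<in>M. c m \<odot>\<^bsub>F\<^esub> lext (der (X m)) f) \<in> R" .
  have "(\<Oplus>\<^bsub>Q\<^esub>m\<in>M. c m \<odot>\<^bsub>Q\<^esub> tensor_act I U act (X m) w)
      = (\<Oplus>\<^bsub>Q\<^esub>m\<in>M. c m \<odot>\<^bsub>Q\<^esub> cls (lext (der (X m)) f))"
    using assms f by (intro Q.finsum_cong')
        (auto simp: w tensor_act_cls cls_smult carrier_Q lext_der_F F_mult smult_free_vs)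
  also have "\<dots> = cls (\<Oplus>\<^bsub>F\<^esub>m\<in>M. c m \<odot>\<^bsub>F\<^esub> lext (der (X m)) f)"
    using assms f by (intro finsum_cls) (auto intro: lext_der_F)
  also have "\<dots> = \<zero>\<^bsub>Q\<^esub>"
    using * H_subset F.a_coset_join2[OF _ subgroup_H] by (auto simp: quotient_vs_def)
  finally show ?thesis by (simp add: Q_eq)
qed

end

section \<open>The twisted affine Lie algebra\<close>

context lie_algebra
begin

lemma smult_L: "x \<in> carrier L \<Longrightarrow> (c :: complex) \<odot> x \<in> carrier L"
  by simp

lemma smult_smult: "x \<in> carrier L \<Longrightarrow> c \<odot> (d \<odot> x) = (c * d) \<odot> x"
  using smult_assoc1[of c d x] by simp

lemma bracket_zero_left: "y \<in> carrier L \<Longrightarrow> bracket L \<zero> y = \<zero>"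
  using bracket_smult_left[of \<zero> y 0] bracket_closed[of \<zero> y] smult_l_null[of \<zero>]
    smult_l_null[of "bracket L \<zero> y"]
  by simp

lemma bracket_zero_right: "y \<in> carrier L \<Longrightarrow> bracket L y \<zero> = \<zero>"
  using bracket_smult_right[of y \<zero> 0] bracket_closed[of y \<zero>] smult_l_null[of \<zero>]
    smult_l_null[of "bracket L y \<zero>"]
  by simp

lemma bracket_anti:
  assumes "x \<in> carrier L" "y \<in> carrier L"
  shows "bracket L x y \<oplus> bracket L y x = \<zero>"
proof -
  have "bracket L x y \<oplus> bracket L y x = bracket L (x \<oplus> y) (x \<oplus> y)"
    using assms a_comm by (simp add: bracket_add_left bracket_add_right bracket_self[of x]
        bracket_self[of y] bracket_closed)
  also have "\<dots> = \<zero>" using assms by (simp add: bracket_self)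
  finally show ?thesis .
qed

end

section \<open>Eigenspaces and the underlying vector space\<close>

locale twisted_setup = invariant_form L B
  for L :: "('g, 'm) lie_alg_scheme" (structure) and B +
  fixes \<sigma> :: "'g \<Rightarrow> 'g" and N :: nat
  assumes aut: "lie_automorphism L \<sigma>" and order: "has_order L \<sigma> N"
begin

abbreviation \<epsilon> :: complex
  where "\<epsilon> \<equiv> exp (2 * of_real pi * \<i> / of_nat N)"

abbreviation E :: "int \<Rightarrow> 'g set"
  where "E \<equiv> eigenspace L \<sigma> N"

abbreviation A :: "((int \<Rightarrow> 'g) \<times> complex) lie_alg"
  where "A \<equiv> twisted_affine L B \<sigma> N"

lemma N_pos: "N > 0"
  using order by (simp add: has_order_def)

lemma sigma_closed: "x \<in> carrier L \<Longrightarrow> \<sigma> x \<in> carrier L"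
  and sigma_add: "\<lbrakk>x \<in> carrier L; y \<in> carrier L\<rbrakk> \<Longrightarrow> \<sigma> (x \<oplus> y) = \<sigma> x \<oplus> \<sigma> y"
  and sigma_smult: "x \<in> carrier L \<Longrightarrow> \<sigma> (c \<odot> x) = c \<odot> \<sigma> x"
  and sigma_bracket: "\<lbrakk>x \<in> carrier L; y \<in> carrier L\<rbrakk> \<Longrightarrow> \<sigma> (bracket L x y) = bracket L (\<sigma> x) (\<sigma> y)"
  using aut by (auto simp: lie_automorphism_def linear_map_def mod_hom_def mod_hom_axioms_def
      LinearCombinations.module_hom_def)

lemma sigma_zero: "\<sigma> \<zero> = \<zero>"
  using sigma_smult[of \<zero> 0] sigma_closed[of \<zero>] smult_l_null[of \<zero>] smult_l_null[of "\<sigma> \<zero>"] by simp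

lemma E_carrier: "a \<in> E k \<Longrightarrow> a \<in> carrier L"
  by (simp add: eigenspace_def)

lemma E_zero: "\<zero> \<in> E k"
  using smult_r_null[of "\<epsilon> powi k"] by (simp add: eigenspace_def sigma_zero)

lemma E_add: "\<lbrakk>a \<in> E k; b \<in> E k\<rbrakk> \<Longrightarrow> a \<oplus> b \<in> E k"
  using smult_r_distr[of "\<epsilon> powi k" a b] by (simp add: eigenspace_def sigma_add)

lemma E_smult: "a \<in> E k \<Longrightarrow> c \<odot> a \<in> E k"
  using smult_assoc1[of "\<epsilon> powi k" c a] smult_assoc1[of c "\<epsilon> powi k" a] smult_closed[of c a]
  by (simp add: eigenspace_def sigma_smult mult.commute)

text \<open>Since \<sigma> preserves brackets, eigenvalues multiply. Indexing the eigenspaces by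
  integers makes the degrees add without reduction modulo \<open>N\<close>.\<close>

lemma E_bracket:
  assumes "a \<in> E p" "b \<in> E q"
  shows "bracket L a b \<in> E (p + q)"
proof -
  have a: "a \<in> carrier L" "\<sigma> a = \<epsilon> powi p \<odot> a" and b: "b \<in> carrier L" "\<sigma> b = \<epsilon> powi q \<odot> b"
    using assms by (auto simp: eigenspace_def)
  have "\<sigma> (bracket L a b) = \<epsilon> powi q \<odot> (\<epsilon> powi p \<odot> bracket L a b)"
    using a b smult_closed[of "\<epsilon> powi q" b]
    by (simp add: sigma_bracket bracket_smult_left bracket_smult_right)
  also have "\<dots> = \<epsilon> powi (p + q) \<odot> bracket L a b"
    using smult_assoc1[of "\<epsilon> powi q" "\<epsilon> powi p" "bracket L a b"] a b
    by (simp add: power_int_add bracket_closed mult.commute)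
  finally show ?thesis using a b by (simp add: eigenspace_def bracket_closed)
qed

lemma mem_A: "X \<in> carrier A \<longleftrightarrow> (\<forall>k. fst X k \<in> E k) \<and> finite (lsupp L X)"
  and add_A: "X \<oplus>\<^bsub>A\<^esub> Y = (\<lambda>k. fst X k \<oplus> fst Y k, snd X + snd Y)"
  and smult_A: "c \<odot>\<^bsub>A\<^esub> X = (\<lambda>k. c \<odot> fst X k, c * snd X)"
  and zero_A: "\<zero>\<^bsub>A\<^esub> = (\<lambda>_. \<zero>, 0)"
  and bracket_A: "bracket A X Y = (\<lambda>k. \<Oplus>p\<in>lsupp L X. bracket L (fst X p) (fst Y (k - p)),
        \<Sum>p\<in>lsupp L X. (of_int p / of_nat N) * B (fst X p) (fst Y (- p)))"
  by (simp_all add: twisted_affine_def)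

lemma A_coeff: "X \<in> carrier A \<Longrightarrow> fst X k \<in> carrier L"
  using E_carrier[of "fst X k" k] by (simp add: mem_A)

lemma A_finite: "X \<in> carrier A \<Longrightarrow> finite (lsupp L X)"
  by (simp add: mem_A)

lemma lsupp_add: "lsupp L (X \<oplus>\<^bsub>A\<^esub> Y) \<subseteq> lsupp L X \<union> lsupp L Y"
  by (auto simp: lsupp_def add_A)

lemma lsupp_smult: "lsupp L (c \<odot>\<^bsub>A\<^esub> X) \<subseteq> lsupp L X"
  using smult_r_null[of c] by (auto simp: lsupp_def smult_A)

lemma A_add: "\<lbrakk>X \<in> carrier A; Y \<in> carrier A\<rbrakk> \<Longrightarrow> X \<oplus>\<^bsub>A\<^esub> Y \<in> carrier A"
  using finite_subset[OF lsupp_add] by (auto simp: mem_A) (simp add: add_A E_add)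

lemma A_smult: "X \<in> carrier A \<Longrightarrow> c \<odot>\<^bsub>A\<^esub> X \<in> carrier A"
  using finite_subset[OF lsupp_smult] by (auto simp: mem_A) (simp add: smult_A E_smult)

lemma A_zero: "\<zero>\<^bsub>A\<^esub> \<in> carrier A"
  by (simp add: zero_A mem_A E_zero lsupp_def)

lemma vectorspace_A: "vectorspace \<complex> A"
proof (rule vectorspace_complexI)
  fix X Y W and c d :: complex
  assume X: "X \<in> carrier A"
  note x = A_coeff[OF X]
  show "X \<oplus>\<^bsub>A\<^esub> \<zero>\<^bsub>A\<^esub> = X" using x by (simp add: add_A zero_A)
  show "0 \<odot>\<^bsub>A\<^esub> X = \<zero>\<^bsub>A\<^esub>" using x smult_l_null by (simp add: smult_A zero_A)
  show "1 \<odot>\<^bsub>A\<^esub> X = X" using x smult_one by (simp add: smult_A)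
  show "(c * d) \<odot>\<^bsub>A\<^esub> X = c \<odot>\<^bsub>A\<^esub> (d \<odot>\<^bsub>A\<^esub> X)"
    using x smult_assoc1[of c d] by (simp add: smult_A)
  show "(c + d) \<odot>\<^bsub>A\<^esub> X = c \<odot>\<^bsub>A\<^esub> X \<oplus>\<^bsub>A\<^esub> d \<odot>\<^bsub>A\<^esub> X"
    using x smult_l_distr[of c d] by (simp add: smult_A add_A algebra_simps)
  assume Y: "Y \<in> carrier A"
  note y = A_coeff[OF Y]
  show "X \<oplus>\<^bsub>A\<^esub> Y = Y \<oplus>\<^bsub>A\<^esub> X" using a_comm[OF x y] by (simp add: add_A add.commute)
  show "c \<odot>\<^bsub>A\<^esub> (X \<oplus>\<^bsub>A\<^esub> Y) = c \<odot>\<^bsub>A\<^esub> X \<oplus>\<^bsub>A\<^esub> c \<odot>\<^bsub>A\<^esub> Y"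
    using smult_r_distr[OF _ x y] by (simp add: smult_A add_A algebra_simps)
  assume W: "W \<in> carrier A"
  note w = A_coeff[OF W]
  show "X \<oplus>\<^bsub>A\<^esub> Y \<oplus>\<^bsub>A\<^esub> W = X \<oplus>\<^bsub>A\<^esub> (Y \<oplus>\<^bsub>A\<^esub> W)"
    using a_assoc[OF x y w] by (simp add: add_A add.assoc)
qed (auto intro: A_zero A_add A_smult)

sublocale A: vectorspace \<complex> A
  by (rule vectorspace_A)

section \<open>Reduction to homogeneous elements, and the bracket\<close>

text \<open>The element \<open>a \<otimes> t^(p/N) + c \<^bold>k\<close>; such elements span the algebra additively.\<close>

definition homog :: "'g \<Rightarrow> int \<Rightarrow> complex \<Rightarrow> (int \<Rightarrow> 'g) \<times> complex"
  where "homog a p c = (\<lambda>k. if k = p then a else \<zero>, c)"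

lemma homog_A: "a \<in> E p \<Longrightarrow> homog a p c \<in> carrier A"
  by (auto simp: homog_def mem_A E_zero lsupp_def intro: finite_subset[of _ "{p}"])

lemma lsupp_homog: "lsupp L (homog a p c) \<subseteq> {p}"
  by (auto simp: lsupp_def homog_def)

text \<open>Induction on a finite set containing the support. Since \<open>homog\<close> carries a
  central coordinate, multiples of the central element need no case of their own.\<close>

lemma affine_induct [consumes 1, case_names homog add]:
  assumes X: "X \<in> carrier A"
    and homog: "\<And>a p c. a \<in> E p \<Longrightarrow> P (homog a p c)"
    and add: "\<And>X Y. \<lbrakk>X \<in> carrier A; Y \<in> carrier A; P X; P Y\<rbrakk> \<Longrightarrow> P (X \<oplus>\<^bsub>A\<^esub> Y)"
  shows "P X"
proof -
  have "\<forall>X\<in>carrier A. lsupp L X \<subseteq> S \<longrightarrow> P X" if "finite S" for S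
    using that
  proof (induction S rule: finite_induct)
    case empty
    \<comment> \<open>With empty support the element is purely central, which is still homogeneous
      with loop coefficient zero.\<close>
    have "X = homog \<zero> 0 (snd X)" if "lsupp L X = {}" for X
      using that by (cases X) (auto simp: lsupp_def homog_def)
    then show ?case using homog[OF E_zero] by (metis subset_empty)
  next
    case (insert k S)
    show ?case
    proof (intro ballI impI)
      fix X assume X: "X \<in> carrier A" and sub: "lsupp L X \<subseteq> insert k S"
      \<comment> \<open>The whole central coordinate stays in \<open>Y\<close>, so the piece split
        off in degree \<open>k\<close> is given central coordinate 0.\<close>
      define Y where "Y = ((fst X)(k := \<zero>), snd X)"
      have Y: "lsupp L Y \<subseteq> S" "lsupp L Y \<subseteq> lsupp L X"
        using sub by (auto simp: Y_def lsupp_def)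
      then have "Y \<in> carrier A"
        using X finite_subset[OF Y(2)] by (auto simp: mem_A Y_def E_zero)
      moreover have "X = homog (fst X k) k 0 \<oplus>\<^bsub>A\<^esub> Y"
        using A_coeff[OF X] by (cases X) (auto simp: homog_def Y_def add_A)
      moreover have "fst X k \<in> E k" using X by (simp add: mem_A)
      ultimately show "P X"
        using insert.IH Y(1) add[OF homog_A] homog by metis
    qed
  qed
  then show ?thesis using X A_finite by blast
qed

lemma affine_induct2 [consumes 2, case_names homog add_left add_right]:
  assumes X: "X \<in> carrier A" and Y: "Y \<in> carrier A"
    and homog: "\<And>a p c b q d. \<lbrakk>a \<in> E p; b \<in> E q\<rbrakk> \<Longrightarrow> P (homog a p c) (homog b q d)"
    and add_left: "\<And>X X' Y. \<lbrakk>X \<in> carrier A; X' \<in> carrier A; Y \<in> carrier A; P X Y; P X' Y\<rbrakk>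
        \<Longrightarrow> P (X \<oplus>\<^bsub>A\<^esub> X') Y"
    and add_right: "\<And>X Y Y'. \<lbrakk>X \<in> carrier A; Y \<in> carrier A; Y' \<in> carrier A; P X Y; P X Y'\<rbrakk>
        \<Longrightarrow> P X (Y \<oplus>\<^bsub>A\<^esub> Y')"
  shows "P X Y"
  using X
proof (induction X rule: affine_induct)
  case (homog a p c)
  show ?case using Y by (induction Y rule: affine_induct) (use homog assms homog_A in auto)
qed (use Y add_left in auto)

text \<open>The defining sum runs over the support of the left argument, which differs from summand
  to summand. A common finite superset turns additivity into a termwise statement.\<close>

lemma fst_bracket:
  assumes "X \<in> carrier A" "Y \<in> carrier A" "finite S" "lsupp L X \<subseteq> S"
  shows "fst (bracket A X Y) k = (\<Oplus>p\<in>S. bracket L (fst X p) (fst Y (k - p)))"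
  unfolding bracket_A fst_conv
  using assms by (intro add.finprod_mono_neutral_cong_left)
    (auto simp: lsupp_def bracket_zero_left A_coeff bracket_closed)

lemma form_zero_left: "y \<in> carrier L \<Longrightarrow> B \<zero> y = 0"
  using form_smult[of \<zero> y 0] smult_l_null[of \<zero>] by simp

lemma form_zero_right: "y \<in> carrier L \<Longrightarrow> B y \<zero> = 0"
  using form_sym[of y \<zero>] form_zero_left by simp

lemma form_add_right: "\<lbrakk>x \<in> carrier L; y \<in> carrier L; w \<in> carrier L\<rbrakk> \<Longrightarrow> B w (x \<oplus> y) = B w x + B w y"
  using form_add[of x y w] form_sym[of w] by simp

lemma form_smult_right: "\<lbrakk>x \<in> carrier L; y \<in> carrier L\<rbrakk> \<Longrightarrow> B x (c \<odot> y) = c * B x y"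
  using form_smult[of y x c] form_sym[of x] smult_closed[of c y] by simp

lemma snd_bracket:
  assumes "X \<in> carrier A" "Y \<in> carrier A" "finite S" "lsupp L X \<subseteq> S"
  shows "snd (bracket A X Y) = (\<Sum>p\<in>S. (of_int p / of_nat N) * B (fst X p) (fst Y (- p)))"
  unfolding bracket_A snd_conv
  using assms by (intro sum.mono_neutral_left)
    (auto simp: lsupp_def form_zero_left A_coeff)

lemma bracket_homog:
  assumes a: "a \<in> E p" and b: "b \<in> E q"
  shows "bracket A (homog a p c) (homog b q d) =
    homog (bracket L a b) (p + q) (if p + q = 0 then of_int p / of_nat N * B a b else 0)"
proof (intro prod_eqI ext)
  note X = homog_A[OF a, of c] and Y = homog_A[OF b, of d]
  note carr = E_carrier[OF a] E_carrier[OF b]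
  fix k
  show "fst (bracket A (homog a p c) (homog b q d)) k =
      fst (homog (bracket L a b) (p + q) (if p + q = 0 then of_int p / of_nat N * B a b else 0)) k"
    using carr fst_bracket[OF X Y finite.insertI[OF finite.emptyI] lsupp_homog, of k]
    by (auto simp: homog_def bracket_zero_right bracket_closed)
next
  note X = homog_A[OF a, of c] and Y = homog_A[OF b, of d]
  note carr = E_carrier[OF a] E_carrier[OF b]
  show "snd (bracket A (homog a p c) (homog b q d)) =
      snd (homog (bracket L a b) (p + q) (if p + q = 0 then of_int p / of_nat N * B a b else 0))"
    using carr snd_bracket[OF X Y finite.insertI[OF finite.emptyI] lsupp_homog]
    by (auto simp: homog_def form_zero_right)
qed

lemma A_bracket_add_left:
  assumes X: "X \<in> carrier A" and Y: "Y \<in> carrier A" and W: "W \<in> carrier A"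
  shows "bracket A (X \<oplus>\<^bsub>A\<^esub> Y) W = bracket A X W \<oplus>\<^bsub>A\<^esub> bracket A Y W"
proof -
  let ?S = "lsupp L X \<union> lsupp L Y"
  have S: "finite ?S" using A_finite[OF X] A_finite[OF Y] by simp
  note XY = A_add[OF X Y]
  note carr = A_coeff[OF X] A_coeff[OF Y] A_coeff[OF W]
  have "fst (bracket A (X \<oplus>\<^bsub>A\<^esub> Y) W) k = fst (bracket A X W) k \<oplus> fst (bracket A Y W) k" for k
  proof -
    have "fst (bracket A (X \<oplus>\<^bsub>A\<^esub> Y) W) k = (\<Oplus>p\<in>?S. bracket L (fst X p \<oplus> fst Y p) (fst W (k - p)))"
      using fst_bracket[OF XY W S lsupp_add] by (simp add: add_A)
    also have "\<dots> = (\<Oplus>p\<in>?S. bracket L (fst X p) (fst W (k - p)) \<oplus> bracket L (fst Y p)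
        (fst W (k - p)))"
      using carr by (simp add: bracket_add_left)
    also have "\<dots> = fst (bracket A X W) k \<oplus> fst (bracket A Y W) k"
      using carr X Y by (simp add: fst_bracket[OF _ W S] finsum_addf bracket_closed)
    finally show ?thesis .
  qed
  moreover have "snd (bracket A (X \<oplus>\<^bsub>A\<^esub> Y) W) = snd (bracket A X W) + snd (bracket A Y W)"
  proof -
    have "snd (bracket A (X \<oplus>\<^bsub>A\<^esub> Y) W)
        = (\<Sum>p\<in>?S. of_int p / of_nat N * B (fst X p \<oplus> fst Y p) (fst W (- p)))"
      using snd_bracket[OF XY W S lsupp_add] by (simp add: add_A)
    also have "\<dots> = snd (bracket A X W) + snd (bracket A Y W)"
      using carr X Y by (simp add: snd_bracket[OF _ W S] form_add sum.distrib distrib_left)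
    finally show ?thesis .
  qed
  ultimately show ?thesis by (subst (2) add_A) (simp add: prod_eq_iff fun_eq_iff)
qed

text \<open>Here the index set is the support of \<open>W\<close>, the same for all three brackets,
  so bilinearity of the original bracket and form applies term by term.\<close>

lemma A_bracket_add_right:
  assumes X: "X \<in> carrier A" and Y: "Y \<in> carrier A" and W: "W \<in> carrier A"
  shows "bracket A W (X \<oplus>\<^bsub>A\<^esub> Y) = bracket A W X \<oplus>\<^bsub>A\<^esub> bracket A W Y"
proof -
  note carr = A_coeff[OF X] A_coeff[OF Y] A_coeff[OF W]
  show ?thesis
    using A_finite[OF W] carr
    by (simp add: bracket_A add_A bracket_add_right bracket_closed form_add_right sum.distrib
        distrib_left finsum_addf)
qed

lemma A_bracket_smult_right:
  assumes X: "X \<in> carrier A" and W: "W \<in> carrier A"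
  shows "bracket A W (c \<odot>\<^bsub>A\<^esub> X) = c \<odot>\<^bsub>A\<^esub> bracket A W X"
proof -
  note carr = A_coeff[OF X] A_coeff[OF W]
  have "c \<odot> (\<Oplus>p\<in>lsupp L W. bracket L (fst W p) (fst X (k - p))) =
      (\<Oplus>p\<in>lsupp L W. c \<odot> bracket L (fst W p) (fst X (k - p)))" for k
    using carr by (intro finsum_smult_ldistr A_finite W) (auto intro: bracket_closed)
  then show ?thesis
    using carr by (simp add: bracket_A smult_A bracket_smult_right form_smult_right
        sum_distrib_left mult.left_commute)
qed

lemma homog_add: "\<lbrakk>a \<in> carrier L; b \<in> carrier L\<rbrakk>
    \<Longrightarrow> homog a p c \<oplus>\<^bsub>A\<^esub> homog b p d = homog (a \<oplus> b) p (c + d)"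
  by (auto simp: homog_def add_A)

lemma homog_zero: "homog \<zero> p 0 = \<zero>\<^bsub>A\<^esub>"
  by (auto simp: homog_def zero_A)

lemma A_bracket_closed: "\<lbrakk>X \<in> carrier A; Y \<in> carrier A\<rbrakk> \<Longrightarrow> bracket A X Y \<in> carrier A"
proof (induction X Y rule: affine_induct2)
  case (homog a p c b q d)
  then show ?case by (simp add: bracket_homog homog_A E_bracket)
qed (simp_all add: A_bracket_add_left A_bracket_add_right A_add)

text \<open>The central term is antisymmetric because it occurs only for q = -p, where the factors
  p/N and q/N are opposite and the form is symmetric.\<close>

lemma A_bracket_anti: "\<lbrakk>X \<in> carrier A; Y \<in> carrier A\<rbrakk> \<Longrightarrow> bracket A X Y \<oplus>\<^bsub>A\<^esub> bracket A Y X = \<zero>\<^bsub>A\<^esub>"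
proof (induction X Y rule: affine_induct2)
  case (homog a p c b q d)
  then have carr: "a \<in> carrier L" "b \<in> carrier L" by (simp_all add: E_carrier)
  have "p + q = 0 \<Longrightarrow> of_int p * B a b + of_int q * B b a = 0"
    using form_sym[OF carr] by (simp add: add_eq_0_iff2)
  then have "(if p + q = 0 then of_int p / of_nat N * B a b else 0)
      + (if q + p = 0 then of_int q / of_nat N * B b a else 0) = 0"
    using N_pos by (simp add: add.commute field_simps)
  then show ?case
    using homog carr homog_zero[of "p + q"]
    by (simp add: bracket_homog add.commute[of q p] homog_add bracket_closed bracket_anti)
next
  case (add_left X X' Y)
  have "bracket A (X \<oplus>\<^bsub>A\<^esub> X') Y \<oplus>\<^bsub>A\<^esub> bracket A Y (X \<oplus>\<^bsub>A\<^esub> X') =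
    (bracket A X Y \<oplus>\<^bsub>A\<^esub> bracket A Y X) \<oplus>\<^bsub>A\<^esub> (bracket A X' Y \<oplus>\<^bsub>A\<^esub> bracket A Y X')"
    using add_left.hyps
    by (simp add: A_bracket_add_left A_bracket_add_right A_bracket_closed A.a_ac)
  then show ?case using add_left by simp
next
  case (add_right X Y Y')
  have "bracket A X (Y \<oplus>\<^bsub>A\<^esub> Y') \<oplus>\<^bsub>A\<^esub> bracket A (Y \<oplus>\<^bsub>A\<^esub> Y') X =
    (bracket A X Y \<oplus>\<^bsub>A\<^esub> bracket A Y X) \<oplus>\<^bsub>A\<^esub> (bracket A X Y' \<oplus>\<^bsub>A\<^esub> bracket A Y' X)"
    using add_right.hyps
    by (simp add: A_bracket_add_left A_bracket_add_right A_bracket_closed A.a_ac)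
  then show ?case using add_right by simp
qed

text \<open>Scaling the left argument by 0 changes the index set of the defining sum; antisymmetry
  transfers the claim from the right argument, where the index set is fixed.\<close>

lemma A_bracket_smult_left:
  assumes X: "X \<in> carrier A" and W: "W \<in> carrier A"
  shows "bracket A (c \<odot>\<^bsub>A\<^esub> X) W = c \<odot>\<^bsub>A\<^esub> bracket A X W"
proof -
  have *: "bracket A Y W = \<ominus>\<^bsub>A\<^esub> bracket A W Y" if "Y \<in> carrier A" for Y
    using A.minus_equality[OF A_bracket_anti[OF that W]] A_bracket_closed that W by simp
  show ?thesis
    using X W A.smult_r_minus[of c "bracket A W X"]
    by (simp add: * A_smult A_bracket_smult_right A_bracket_closed)
qed

lemma A_bracket_self: "X \<in> carrier A \<Longrightarrow> bracket A X X = \<zero>\<^bsub>A\<^esub>"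
proof (induction X rule: affine_induct)
  case (homog a p c)
  then show ?case
    using bracket_homog[OF homog homog, of c c] homog_zero by (auto simp: bracket_self E_carrier)
next
  case (add X Y)
  have "bracket A (X \<oplus>\<^bsub>A\<^esub> Y) (X \<oplus>\<^bsub>A\<^esub> Y) =
    (bracket A X X \<oplus>\<^bsub>A\<^esub> bracket A Y Y) \<oplus>\<^bsub>A\<^esub> (bracket A X Y \<oplus>\<^bsub>A\<^esub> bracket A Y X)"
    using add.hyps by (simp add: A_bracket_add_left A_bracket_add_right A_bracket_closed A_add
        A.a_ac)
  then show ?case using add by (simp add: A_bracket_anti A_zero)
qed

section \<open>The Jacobi identity\<close>

definition jacobiator ::
    "(int \<Rightarrow> 'g) \<times> complex \<Rightarrow> (int \<Rightarrow> 'g) \<times> complex \<Rightarrow> (int \<Rightarrow> 'g) \<times> complex \<Rightarrow> (int \<Rightarrow> 'g) \<times> complex"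
  where "jacobiator X Y W = bracket A X (bracket A Y W) \<oplus>\<^bsub>A\<^esub> bracket A Y (bracket A W X)
              \<oplus>\<^bsub>A\<^esub> bracket A W (bracket A X Y)"

text \<open>With this cyclic symmetry, additivity in the first argument serves for all
  three.\<close>

lemma jacobiator_rotate: "\<lbrakk>X \<in> carrier A; Y \<in> carrier A; W \<in> carrier A\<rbrakk>
    \<Longrightarrow> jacobiator X Y W = jacobiator Y W X"
  by (simp add: jacobiator_def A_bracket_closed A.a_ac)

lemma jacobiator_add:
  assumes "X \<in> carrier A" "X' \<in> carrier A" "Y \<in> carrier A" "W \<in> carrier A"
    and "jacobiator X Y W = \<zero>\<^bsub>A\<^esub>" "jacobiator X' Y W = \<zero>\<^bsub>A\<^esub>"
  shows "jacobiator (X \<oplus>\<^bsub>A\<^esub> X') Y W = \<zero>\<^bsub>A\<^esub>"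
proof -
  have "jacobiator (X \<oplus>\<^bsub>A\<^esub> X') Y W = jacobiator X Y W \<oplus>\<^bsub>A\<^esub> jacobiator X' Y W"
    using assms(1-4) by (simp add: jacobiator_def A_bracket_add_left A_bracket_add_right
        A_bracket_closed A.a_ac)
  then show ?thesis using assms by (simp add: A_zero)
qed

text \<open>The loop part is the Jacobi identity of the original algebra. For the central part,
  invariance and symmetry make the three form values equal to \<open>B a (bracket L b h)\<close>;
  their coefficients add up to (p + q + r)/N, and the term occurs only when p + q + r = 0.\<close>

lemma jacobiator_homog:
  assumes a: "a \<in> E p" and b: "b \<in> E q" and h: "h \<in> E r"
  shows "jacobiator (homog a p c) (homog b q d) (homog h r e) = \<zero>\<^bsub>A\<^esub>"
proof -
  note carr = E_carrier[OF a] E_carrier[OF b] E_carrier[OF h]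
  let ?ab = "bracket L a b" and ?bh = "bracket L b h" and ?ha = "bracket L h a"
  have B: "B b ?ha = B a ?bh" "B h ?ab = B a ?bh"
    using carr form_invariant[of a b h] form_invariant[of h a b] form_sym[of h ?ab]
        form_sym[of b ?ha]
    by (simp_all add: bracket_closed)
  have "bracket A (homog a p c) (bracket A (homog b q d) (homog h r e))
      = homog (bracket L a ?bh) (p + q + r)
      (if p + q + r = 0 then of_int p / of_nat N * B a ?bh else 0)"
    using bracket_homog[OF b h, of d e] bracket_homog[OF a E_bracket[OF b h], of c]
    by (simp add: add.assoc)
  moreover have "bracket A (homog b q d) (bracket A (homog h r e) (homog a p c))
      = homog (bracket L b ?ha) (p + q + r)
      (if p + q + r = 0 then of_int q / of_nat N * B a ?bh else 0)"
    using bracket_homog[OF h a, of e c] bracket_homog[OF b E_bracket[OF h a], of d] B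
    by (simp add: ac_simps)
  moreover have "bracket A (homog h r e) (bracket A (homog a p c) (homog b q d))
      = homog (bracket L h ?ab) (p + q + r)
      (if p + q + r = 0 then of_int r / of_nat N * B a ?bh else 0)"
    using bracket_homog[OF a b, of c d] bracket_homog[OF h E_bracket[OF a b], of e] B
    by (simp add: ac_simps)
  moreover have "(if p + q + r = 0 then of_int p / of_nat N * B a ?bh else 0)
    + (if p + q + r = 0 then of_int q / of_nat N * B a ?bh else 0)
    + (if p + q + r = 0 then of_int r / of_nat N * B a ?bh else 0) = 0"
  proof (cases "p + q + r = 0")
    case True
    have "of_int p / of_nat N * B a ?bh + of_int q / of_nat N * B a ?bh
        + of_int r / of_nat N * B a ?bh
      = of_int (p + q + r) / of_nat N * B a ?bh"
      by (simp add: add_divide_distrib distrib_right)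
    then show ?thesis using True by simp
  qed auto
  ultimately show ?thesis
    unfolding jacobiator_def using carr homog_zero[of "p + q + r"] jacobi[OF carr]
    by (simp only: homog_add bracket_closed M.add.m_closed)
qed

text \<open>Additivity reduces each argument to homogeneous elements. Sums in the second or third
  argument are first rotated to the front, where \<open>jacobiator_add\<close> applies.\<close>

lemma jacobiator_zero: "\<lbrakk>X \<in> carrier A; Y \<in> carrier A; W \<in> carrier A\<rbrakk> \<Longrightarrow> jacobiator X Y W = \<zero>\<^bsub>A\<^esub>"
proof (induction X Y arbitrary: W rule: affine_induct2)
  case (homog a p c b q d)
  note ab = homog_A[OF homog.hyps(1), of c] homog_A[OF homog.hyps(2), of d]
  from homog.prems show ?case
  proof (induction W rule: affine_induct)
    case (homog h r e)
    show ?case by (rule jacobiator_homog) fact+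
  next
    case (add W W')
    then show ?case
      using ab by (simp add: jacobiator_rotate[symmetric, of _ "homog a p c"] A_add jacobiator_add)
  qed
next
  case (add_left X X' Y)
  then show ?case by (simp add: jacobiator_add)
next
  case (add_right X Y Y')
  then have "jacobiator Y W X = \<zero>\<^bsub>A\<^esub>" "jacobiator Y' W X = \<zero>\<^bsub>A\<^esub>"
    by (simp_all flip: jacobiator_rotate)
  then show ?case using add_right by (simp add: jacobiator_rotate[of X] A_add jacobiator_add)
qed

lemma lie_algebra_A: "lie_algebra A"
  by (intro lie_algebra.intro vectorspace_A lie_algebra_axioms.intro A_bracket_closed
      A_bracket_add_left A_bracket_add_right A_bracket_smult_left A_bracket_smult_right
      A_bracket_self jacobiator_zero[unfolded jacobiator_def])

end

section \<open>Evaluation modules\<close>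

lemma (in lie_module) act_finsum:
  assumes "finite S" "\<And>i. i \<in> S \<Longrightarrow> f i \<in> carrier L" "u \<in> carrier M"
  shows "act (\<Oplus>\<^bsub>L\<^esub>i\<in>S. f i) u = (\<Oplus>\<^bsub>M\<^esub>i\<in>S. act (f i) u)"
  using assms(1,2)
proof (induction S rule: finite_induct)
  case empty
  have "act \<zero>\<^bsub>L\<^esub> u = 0 \<odot>\<^bsub>M\<^esub> act \<zero>\<^bsub>L\<^esub> u"
    using act_smult_left[of "\<zero>\<^bsub>L\<^esub>" u 0] smult_l_null[of "\<zero>\<^bsub>L\<^esub>"] assms(3) by simp
  then show ?case using M.smult_l_null[of "act \<zero>\<^bsub>L\<^esub> u"] act_closed[of "\<zero>\<^bsub>L\<^esub>" u] assms(3) by simp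
next
  case (insert i S)
  have "f \<in> S \<rightarrow> carrier L" "f i \<in> carrier L" using insert.prems by auto
  moreover have "(\<lambda>i. act (f i) u) \<in> S \<rightarrow> carrier M" "act (f i) u \<in> carrier M"
    using insert.prems act_closed assms(3) by auto
  ultimately show ?case
    using insert assms(3) by (simp add: act_add_left)
qed

section \<open>The evaluation homomorphism\<close>

context twisted_setup
begin

definition ev :: "complex \<Rightarrow> (int \<Rightarrow> 'g) \<times> complex \<Rightarrow> 'g"
  where "ev \<zeta> X = (\<Oplus>k\<in>lsupp L X. \<zeta> powi k \<odot> fst X k)"

lemma ev_superset:
  assumes "X \<in> carrier A" "finite S" "lsupp L X \<subseteq> S"
  shows "ev \<zeta> X = (\<Oplus>k\<in>S. \<zeta> powi k \<odot> fst X k)"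
  unfolding ev_def
proof (rule add.finprod_mono_neutral_cong_left)
  show "\<zeta> powi k \<odot> fst X k = \<zero>" if "k \<in> S - lsupp L X" for k
    using that smult_r_null[of "\<zeta> powi k"] by (simp add: lsupp_def)
qed (use assms in \<open>auto intro: smult_L A_coeff\<close>)

lemma ev_closed: "X \<in> carrier A \<Longrightarrow> ev \<zeta> X \<in> carrier L"
  unfolding ev_def by (intro finsum_closed) (auto intro: smult_L A_coeff)

lemma ev_add:
  assumes X: "X \<in> carrier A" and Y: "Y \<in> carrier A"
  shows "ev \<zeta> (X \<oplus>\<^bsub>A\<^esub> Y) = ev \<zeta> X \<oplus> ev \<zeta> Y"
proof -
  let ?S = "lsupp L X \<union> lsupp L Y"
  have S: "finite ?S" using A_finite[OF X] A_finite[OF Y] by simp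
  note carr = A_coeff[OF X] A_coeff[OF Y]
  have "ev \<zeta> (X \<oplus>\<^bsub>A\<^esub> Y) = (\<Oplus>k\<in>?S. \<zeta> powi k \<odot> (fst X k \<oplus> fst Y k))"
    using ev_superset[OF A_add[OF X Y] S lsupp_add] by (simp add: add_A)
  also have "\<dots> = (\<Oplus>k\<in>?S. \<zeta> powi k \<odot> fst X k \<oplus> \<zeta> powi k \<odot> fst Y k)"
    using carr smult_r_distr by simp
  also have "\<dots> = ev \<zeta> X \<oplus> ev \<zeta> Y"
    using carr by (simp add: ev_superset[OF X S] ev_superset[OF Y S] finsum_addf)
  finally show ?thesis .
qed

lemma ev_smult:
  assumes X: "X \<in> carrier A"
  shows "ev \<zeta> (c \<odot>\<^bsub>A\<^esub> X) = c \<odot> ev \<zeta> X"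
proof -
  note carr = A_coeff[OF X]
  have "ev \<zeta> (c \<odot>\<^bsub>A\<^esub> X) = (\<Oplus>k\<in>lsupp L X. \<zeta> powi k \<odot> (c \<odot> fst X k))"
    using ev_superset[OF A_smult[OF X] A_finite[OF X] lsupp_smult] by (simp add: smult_A)
  also have "\<dots> = (\<Oplus>k\<in>lsupp L X. c \<odot> (\<zeta> powi k \<odot> fst X k))"
    using carr smult_assoc1[of c "\<zeta> powi _"] smult_assoc1[of "\<zeta> powi _" c]
    by (simp add: mult.commute)
  also have "\<dots> = c \<odot> ev \<zeta> X"
    unfolding ev_def using carr A_finite[OF X] by (intro finsum_smult_ldistr[symmetric]) auto
  finally show ?thesis .
qed

lemma ev_homog: "a \<in> E p \<Longrightarrow> ev \<zeta> (homog a p c) = \<zeta> powi p \<odot> a"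
  using ev_superset[OF homog_A _ lsupp_homog, of a p _ c] E_carrier[of a p]
  by (simp add: homog_def)

text \<open>Evaluation discards the central coordinate, so only the loop part matters, and there
  powers of \<zeta> multiply. Degrees may be negative, hence the need for an invertible
  \<zeta>.\<close>

lemma ev_bracket:
  assumes "\<zeta> \<noteq> 0"
  shows "\<lbrakk>X \<in> carrier A; Y \<in> carrier A\<rbrakk> \<Longrightarrow> ev \<zeta> (bracket A X Y) = bracket L (ev \<zeta> X) (ev \<zeta> Y)"
proof (induction X Y rule: affine_induct2)
  case (homog a p c b q d)
  then have carr: "a \<in> carrier L" "b \<in> carrier L" by (simp_all add: E_carrier)
  have "bracket L (\<zeta> powi p \<odot> a) (\<zeta> powi q \<odot> b) = \<zeta> powi q \<odot> (\<zeta> powi p \<odot> bracket L a b)"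
    using carr by (simp add: bracket_smult_left bracket_smult_right bracket_closed)
  also have "\<dots> = \<zeta> powi (p + q) \<odot> bracket L a b"
    using smult_assoc1[of "\<zeta> powi q" "\<zeta> powi p" "bracket L a b"] carr assms
    by (simp add: power_int_add bracket_closed mult.commute)
  finally show ?case using homog by (simp add: bracket_homog ev_homog E_bracket)
next
  case (add_left X X' Y)
  then show ?case
    by (simp add: A_bracket_add_left ev_add A_bracket_closed bracket_add_left ev_closed)
next
  case (add_right X Y Y')
  then show ?case
    by (simp add: A_bracket_add_right ev_add A_bracket_closed bracket_add_right ev_closed)
qed

text \<open>Division with remainder, k = N (k div N) + k mod N, merges the integral power of
  \<open>z\<close> and the power of its root into one power of \<zeta>. This makes the scalar
  multiplicative in \<open>k\<close>.\<close>

lemma eval_coefficient: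
  fixes \<zeta> z :: complex
  assumes "\<zeta> ^ N = z" "z \<noteq> 0"
  shows "z powi (k div int N) * \<zeta> ^ nat (k mod int N) = \<zeta> powi k"
proof -
  have "\<zeta> \<noteq> 0" using assms N_pos by (auto simp: zero_power)
  have "z powi (k div int N) = \<zeta> powi (int N * (k div int N))"
    using assms by (simp add: power_int_mult)
  moreover have "\<zeta> ^ nat (k mod int N) = \<zeta> powi (k mod int N)"
    using N_pos by (simp add: power_int_def)
  ultimately show ?thesis
    using \<open>\<zeta> \<noteq> 0\<close> by (simp flip: power_int_add)
qed

lemma eval_act_eq:
  assumes U: "lie_module L U act" and \<zeta>: "\<zeta> ^ N = z" "z \<noteq> 0"
    and X: "X \<in> carrier A" and u: "u \<in> carrier U"
  shows "eval_act L N U act z \<zeta> X u = act (ev \<zeta> X) u"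
proof -
  interpret U: lie_module L U act by (rule U)
  show ?thesis
    unfolding eval_act_def ev_def eval_coefficient[OF \<zeta>]
    using U.act_finsum[OF A_finite[OF X], of "\<lambda>k. \<zeta> powi k \<odot> fst X k" u] u A_coeff[OF X]
    by (simp add: U.act_smult_left)
qed

lemma lie_module_eval:
  assumes U: "lie_module L U act" and \<zeta>: "\<zeta> ^ N = z" "z \<noteq> 0"
  shows "lie_module A U (eval_act L N U act z \<zeta>)"
proof -
  interpret U: lie_module L U act by (rule U)
  have "\<zeta> \<noteq> 0" using \<zeta> N_pos by (auto simp: zero_power)
  note eq = eval_act_eq[OF U \<zeta>] and cl = A_add A_smult A_bracket_closed ev_closed U.act_closed
  show ?thesis
  proof (intro lie_module.intro lie_algebra_A U.M.vectorspace_axioms lie_module_axioms.intro)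
  qed (simp_all add: eq cl ev_add ev_smult ev_bracket[OF \<open>\<zeta> \<noteq> 0\<close>]
      U.act_add_left U.act_add_right U.act_smult_left U.act_smult_right U.act_bracket)
qed

end

section \<open>The eigenspace decomposition\<close>

lemma (in abelian_monoid) finsum_swap:
  assumes "finite S" "finite T" "\<And>i j. \<lbrakk>i \<in> S; j \<in> T\<rbrakk> \<Longrightarrow> f i j \<in> carrier G"
  shows "(\<Oplus>i\<in>S. \<Oplus>j\<in>T. f i j) = (\<Oplus>j\<in>T. \<Oplus>i\<in>S. f i j)"
  using assms(1,3)
proof (induction S rule: finite_induct)
  case empty
  then show ?case by simp
next
  case (insert i S)
  have *: "(\<lambda>i. \<Oplus>j\<in>T. f i j) \<in> S \<rightarrow> carrier G" "(\<lambda>j. f i j) \<in> T \<rightarrow> carrier G"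
    "(\<lambda>j. \<Oplus>i\<in>S. f i j) \<in> T \<rightarrow> carrier G"
    using insert.prems by (auto intro!: finsum_closed)
  have "(\<Oplus>j\<in>T. \<Oplus>i\<in>insert i S. f i j) = (\<Oplus>j\<in>T. f i j \<oplus> (\<Oplus>i\<in>S. f i j))"
  proof (rule finsum_cong')
    fix j assume j: "j \<in> T"
    then have "(\<lambda>i. f i j) \<in> S \<rightarrow> carrier G" "f i j \<in> carrier G" using insert.prems by auto
    then show "(\<Oplus>i\<in>insert i S. f i j) = f i j \<oplus> (\<Oplus>i\<in>S. f i j)"
      using insert.hyps by simp
  qed (use insert.prems in \<open>auto intro!: finsum_closed\<close>)
  also have "\<dots> = (\<Oplus>j\<in>T. f i j) \<oplus> (\<Oplus>j\<in>T. \<Oplus>i\<in>S. f i j)"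
    using * by (intro finsum_addf)
  finally show ?case
    using * insert by simp
qed

lemma (in lie_algebra) finsum_smult_right:
  assumes "finite S" "x \<in> carrier L"
  shows "(\<Oplus>i\<in>S. (f i :: complex) \<odot> x) = (\<Sum>i\<in>S. f i) \<odot> x"
  using assms(1)
proof (induction S rule: finite_induct)
  case empty
  then show ?case using smult_l_null[OF assms(2)] by simp
next
  case (insert i S)
  then show ?case using assms(2) smult_l_distr[of "f i" "sum f S" x] by (simp add: Pi_iff)
qed

context twisted_setup
begin

section \<open>Roots of unity and character sums\<close>

lemma eps_cis: "\<epsilon> = cis (2 * pi / of_nat N)"
  by (simp add: cis_conv_exp mult.commute)

lemma eps_power_N: "\<epsilon> ^ N = 1"
  using N_pos by (simp add: eps_cis DeMoivre)

lemma eps_nz: "\<epsilon> \<noteq> 0"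
  by simp

lemma eps_powi_mod: "\<epsilon> powi k = \<epsilon> ^ nat (k mod int N)"
proof -
  have "\<epsilon> powi k = \<epsilon> powi (int N * (k div int N)) * \<epsilon> powi (k mod int N)"
    using eps_nz by (simp del: exp_not_eq_zero flip: power_int_add)
  also have "\<epsilon> powi (int N * (k div int N)) = 1"
    using eps_power_N by (simp add: power_int_mult)
  also have "\<epsilon> powi (k mod int N) = \<epsilon> ^ nat (k mod int N)"
    using N_pos by (simp add: power_int_def)
  finally show ?thesis by simp
qed

text \<open>Primitivity of \<epsilon>: after reducing the exponent modulo \<open>N\<close>,
  injectivity of the standard enumeration of the N-th roots of unity decides the question.\<close>

lemma eps_powi_eq_1: "\<epsilon> powi k = 1 \<longleftrightarrow> int N dvd k"
proof -
  let ?f = "\<lambda>k. cis (2 * pi * real k / real N)"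
  define m where "m = nat (k mod int N)"
  have m: "m < N" using N_pos by (simp add: m_def nat_less_iff)
  have "\<epsilon> powi k = \<epsilon> ^ m" unfolding m_def by (rule eps_powi_mod)
  also have "\<dots> = ?f m" by (subst eps_cis) (simp add: DeMoivre mult_ac)
  finally have "\<epsilon> powi k = 1 \<longleftrightarrow> ?f m = ?f 0" by simp
  also have "\<dots> \<longleftrightarrow> m = 0"
    using bij_betw_roots_unity[OF N_pos] m N_pos
    by (intro inj_on_eq_iff[of _ "{..<N}"]) (auto simp: bij_betw_def)
  also have "\<dots> \<longleftrightarrow> int N dvd k"
  proof -
    have "0 \<le> k mod int N" using N_pos by simp
    then show ?thesis by (auto simp: m_def dvd_eq_mod_eq_0)
  qed
  finally show ?thesis .
qed

text \<open>Orthogonality of characters of the cyclic group of order \<open>N\<close>: the base is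
  an N-th root of unity, so the geometric sum vanishes unless the base is 1.\<close>

lemma sum_eps: "(\<Sum>j<N. (\<epsilon> powi k) ^ j) = (if int N dvd k then of_nat N else 0)"
proof (cases "int N dvd k")
  case True
  then show ?thesis using eps_powi_eq_1[of k] by simp
next
  case False
  have "(\<epsilon> powi k) ^ N = \<epsilon> powi (int N * k)"
    by (simp only: power_int_power' mult.commute[of k])
  also have "\<dots> = (\<epsilon> powi int N) powi k" by (rule power_int_mult)
  also have "\<dots> = 1" using eps_power_N by simp
  finally show ?thesis using False eps_powi_eq_1[of k] by (simp add: sum_gp_strict)
qed

section \<open>Spectral projections of \<sigma>\<close>

lemma sigma_pow_closed: "x \<in> carrier L \<Longrightarrow> (\<sigma> ^^ j) x \<in> carrier L"
  by (induction j) (auto intro: sigma_closed)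

lemma sigma_pow_add: "\<lbrakk>x \<in> carrier L; y \<in> carrier L\<rbrakk> \<Longrightarrow> (\<sigma> ^^ j) (x \<oplus> y) = (\<sigma> ^^ j) x \<oplus> (\<sigma> ^^ j) y"
  by (induction j) (auto simp: sigma_add sigma_pow_closed)

lemma sigma_pow_E: "b \<in> E k \<Longrightarrow> (\<sigma> ^^ j) b = (\<epsilon> powi k) ^ j \<odot> b"
proof (induction j)
  case 0
  then show ?case using smult_one[OF E_carrier] by simp
next
  case (Suc j)
  have b: "b \<in> carrier L" "\<sigma> b = \<epsilon> powi k \<odot> b" using Suc.prems by (auto simp: eigenspace_def)
  then show ?case
    using Suc smult_assoc1[of "(\<epsilon> powi k) ^ j" "\<epsilon> powi k" b] by (simp add: sigma_smult mult.commute)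
qed

text \<open>The discrete Fourier transform along the orbit of \<sigma>: the projection onto
  \<open>E i\<close> in the eigenspace decomposition.\<close>

definition proj :: "int \<Rightarrow> 'g \<Rightarrow> 'g"
  where "proj i a = (\<Oplus>j\<in>{..<N}. (\<epsilon> powi (- i * int j) / of_nat N) \<odot> (\<sigma> ^^ j) a)"

lemma proj_closed: "a \<in> carrier L \<Longrightarrow> proj i a \<in> carrier L"
  unfolding proj_def by (intro finsum_closed) (auto intro: smult_L sigma_pow_closed)

lemma proj_add:
  assumes "a \<in> carrier L" "b \<in> carrier L"
  shows "proj i (a \<oplus> b) = proj i a \<oplus> proj i b"
proof -
  note carr = sigma_pow_closed[OF assms(1)] sigma_pow_closed[OF assms(2)]
  have "proj i (a \<oplus> b) = (\<Oplus>j\<in>{..<N}. (\<epsilon> powi (- i * int j) / of_nat N) \<odot> (\<sigma> ^^ j) a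
      \<oplus> (\<epsilon> powi (- i * int j) / of_nat N) \<odot> (\<sigma> ^^ j) b)"
    unfolding proj_def sigma_pow_add[OF assms] using smult_r_distr[OF _ carr] by simp
  also have "\<dots> = proj i a \<oplus> proj i b"
    unfolding proj_def using carr by (intro finsum_addf) auto
  finally show ?thesis .
qed

text \<open>On an eigenvector the powers of \<sigma> become powers of a scalar, and the average
  becomes a character sum.\<close>

lemma proj_E:
  assumes b: "b \<in> E k"
  shows "proj i b = (if int N dvd k - i then b else \<zero>)"
proof -
  have carr: "b \<in> carrier L" by (rule E_carrier[OF b])
  have "proj i b = (\<Oplus>j\<in>{..<N}. ((\<epsilon> powi (k - i)) ^ j / of_nat N) \<odot> b)"
  proof -
    have "(\<epsilon> powi (- i * int j) / of_nat N) \<odot> (\<sigma> ^^ j) b = ((\<epsilon> powi (k - i)) ^ j / of_nat N) \<odot> b"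
        for j
    proof -
      have "\<epsilon> powi (- i * int j) * (\<epsilon> powi k) ^ j = (\<epsilon> powi (k - i)) ^ j"
        unfolding power_int_power' using eps_nz
        by (simp del: exp_not_eq_zero add: algebra_simps flip: power_int_add)
      then show ?thesis
        using smult_assoc1[of "\<epsilon> powi (- i * int j) / of_nat N" "(\<epsilon> powi k) ^ j" b] carr
        by (simp add: sigma_pow_E[OF b])
    qed
    then show ?thesis by (simp add: proj_def)
  qed
  also have "\<dots> = ((\<Sum>j<N. (\<epsilon> powi (k - i)) ^ j) / of_nat N) \<odot> b"
    using carr by (simp add: finsum_smult_right sum_divide_distrib)
  finally show ?thesis
    using N_pos smult_one[OF carr] smult_l_null[OF carr] by (simp add: sum_eps)
qed

lemma proj_finsum:
  assumes "finite S" "\<And>k. k \<in> S \<Longrightarrow> f k \<in> carrier L"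
  shows "proj i (\<Oplus>k\<in>S. f k) = (\<Oplus>k\<in>S. proj i (f k))"
  using assms
proof (induction S rule: finite_induct)
  case empty
  then show ?case using proj_E[OF E_zero] by simp
next
  case (insert k S)
  then have "f \<in> S \<rightarrow> carrier L" "f k \<in> carrier L" "(\<lambda>k. proj i (f k)) \<in> S \<rightarrow> carrier L"
      "proj i (f k) \<in> carrier L"
    by (auto intro: proj_closed)
  then show ?case using insert by (simp add: proj_add)
qed

text \<open>Applying \<open>proj i\<close> to any decomposition kills every summand except the one
  in degree \<open>i\<close>, so the summands are recovered from \<open>a\<close>.\<close>

lemma decomposition_unique:
  assumes c: "c \<in> (\<Pi>\<^sub>E i\<in>{0..<int N}. E i)" and a: "a = (\<Oplus>i\<in>{0..<int N}. c i)"
  shows "c = restrict (\<lambda>i. proj i a) {0..<int N}"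
proof (rule extensionalityI)
  show "c \<in> extensional {0..<int N}" using c by (simp add: PiE_def)
  fix i assume i: "i \<in> {0..<int N}"
  have c_E: "k \<in> {0..<int N} \<Longrightarrow> c k \<in> E k" for k using c by auto
  then have c_L: "k \<in> {0..<int N} \<Longrightarrow> c k \<in> carrier L" for k using E_carrier by blast
  have "proj i a = (\<Oplus>k\<in>{0..<int N}. proj i (c k))"
    unfolding a by (intro proj_finsum) (auto intro: c_L)
  also have "\<dots> = (\<Oplus>k\<in>{0..<int N}. if i = k then c k else \<zero>)"
  proof (rule finsum_cong')
    fix k assume k: "k \<in> {0..<int N}"
    \<comment> \<open>Both indices lie in one period, so their difference is smaller than
      \<open>N\<close> in absolute value.\<close>
    have "int N dvd k - i \<longleftrightarrow> i = k"
      using i k by (auto simp: zdvd_not_zless dest: zdvd_imp_le)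
        (smt (verit) zdvd_imp_le dvd_minus_iff)
    then show "proj i (c k) = (if i = k then c k else \<zero>)"
      using proj_E[OF c_E[OF k]] by simp
  qed (auto simp: c_L)
  also have "\<dots> = c i"
    using i by (intro finsum_singleton) (auto intro: c_L)
  finally show "c i = restrict (\<lambda>i. proj i a) {0..<int N} i" using i by simp
qed simp

lemma proj_in_E:
  assumes a: "a \<in> carrier L"
  shows "proj i a \<in> E i"
proof -
  obtain n where n: "N = Suc n" using N_pos by (cases N) auto
  define g where "g j = (\<epsilon> powi (- i * int j) / of_nat N) \<odot> (\<sigma> ^^ j) a" for j
  have g: "g j \<in> carrier L" for j
    unfolding g_def by (intro smult_L sigma_pow_closed a)
  have "g N = g 0"
  proof -
    have "\<epsilon> powi (- i * int N) = 1" using eps_powi_eq_1 by auto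
    moreover have "(\<sigma> ^^ N) a = a" using order a by (simp add: has_order_def)
    ultimately show ?thesis by (simp add: g_def)
  qed
  \<comment> \<open>Both sides are the sum of \<open>g\<close> over \<open>{..N}\<close>, split at
    the first and at the last index; \<open>g N = g 0\<close> makes the shift of the index
    cyclic.\<close>
  then have "(\<Oplus>j\<in>{..n}. g (Suc j)) \<oplus> g 0 = (\<Oplus>j\<in>{..n}. g j) \<oplus> g 0"
    using finsum_Suc[of g n] finsum_Suc2[of g n] g a_comm n by simp
  then have shift: "(\<Oplus>j\<in>{..n}. g (Suc j)) = (\<Oplus>j\<in>{..n}. g j)"
    using g by simp
  have sum: "\<sigma> (\<Oplus>j\<in>S. g j) = (\<Oplus>j\<in>S. \<sigma> (g j))" if "finite S" for S :: "nat set"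
    using that
  proof (induction S rule: finite_induct)
    case (insert j S)
    then show ?case using g by (simp add: Pi_iff sigma_closed sigma_add)
  qed (simp add: sigma_zero)
  \<comment> \<open>Applying \<sigma> raises the power of \<sigma> by one, and the weight of the
    next term differs by the factor \<epsilon> powi i that an eigenvector in degree \<open>i\<close>
    requires.\<close>
  have "\<sigma> (g j) = \<epsilon> powi i \<odot> g (Suc j)" for j
  proof -
    have "\<epsilon> powi i * (\<epsilon> powi (- i * int (Suc j)) / of_nat N) = \<epsilon> powi (- i * int j) / of_nat N"
      using eps_nz by (simp del: exp_not_eq_zero add: algebra_simps flip: power_int_add)
    then have "\<epsilon> powi i \<odot> g (Suc j) = (\<epsilon> powi (- i * int j) / of_nat N) \<odot> (\<sigma> ^^ Suc j) a"
      by (simp only: g_def smult_smult[OF sigma_pow_closed[OF a]])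
    then show ?thesis
      using sigma_pow_closed[OF a] by (simp add: g_def sigma_smult)
  qed
  then have "\<sigma> (\<Oplus>j\<in>{..n}. g j) = (\<Oplus>j\<in>{..n}. \<epsilon> powi i \<odot> g (Suc j))"
    using sum by simp
  also have "\<dots> = \<epsilon> powi i \<odot> (\<Oplus>j\<in>{..n}. g (Suc j))"
    using g by (intro finsum_smult_ldistr[symmetric]) auto
  finally have "\<sigma> (\<Oplus>j\<in>{..n}. g j) = \<epsilon> powi i \<odot> (\<Oplus>j\<in>{..n}. g j)"
    using shift by simp
  moreover have "proj i a = (\<Oplus>j\<in>{..n}. g j)"
    unfolding proj_def g_def by (simp only: n lessThan_Suc_atMost)
  ultimately show ?thesis using proj_closed[OF a, of i] by (simp add: eigenspace_def)
qed

text \<open>Fourier inversion: after interchanging the sums, the coefficient of each power of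
  \<sigma> is a character sum over \<open>i\<close>, and only the zeroth power survives.\<close>

lemma proj_sum:
  assumes a: "a \<in> carrier L"
  shows "(\<Oplus>i\<in>{0..<int N}. proj i a) = a"
proof -
  have carr: "(\<sigma> ^^ j) a \<in> carrier L" for j by (rule sigma_pow_closed[OF a])
  have coeff: "(\<Sum>i\<in>{0..<int N}. \<epsilon> powi (- i * int j) / of_nat N) = (if j = 0 then 1 else 0)"
      if "j < N" for j
  proof -
    have "(\<Sum>i\<in>{0..<int N}. \<epsilon> powi (- i * int j) / of_nat N)
        = (\<Sum>i<N. \<epsilon> powi (- int i * int j) / of_nat N)"
    proof -
      have "{0..<int N} = int ` {..<N}"
        using image_int_atLeastLessThan[of 0 N] by (simp add: atLeast0LessThan)
      then show ?thesis by (simp add: sum.reindex)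
    qed
    also have "\<dots> = (\<Sum>i<N. (\<epsilon> powi (- int j)) ^ i) / of_nat N"
      by (simp add: sum_divide_distrib power_int_power' mult.commute del: power_int_minus)
    also have "\<dots> = (if j = 0 then 1 else 0)"
      using that N_pos by (auto simp: sum_eps[of "- int j"]
          simp del: power_int_minus dest: dvd_imp_le)
    finally show ?thesis .
  qed
  have "(\<Oplus>i\<in>{0..<int N}. proj i a) =
      (\<Oplus>j\<in>{..<N}. \<Oplus>i\<in>{0..<int N}. (\<epsilon> powi (- i * int j) / of_nat N) \<odot> (\<sigma> ^^ j) a)"
    unfolding proj_def using carr by (intro finsum_swap) (auto intro: smult_L)
  also have "\<dots> = (\<Oplus>j\<in>{..<N}. (\<Sum>i\<in>{0..<int N}. \<epsilon> powi (- i * int j) / of_nat N) \<odot> (\<sigma> ^^ j) a)"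
    using carr by (simp only: finsum_smult_right finite_atLeastLessThan_int)
  also have "\<dots> = (\<Oplus>j\<in>{..<N}. if 0 = j then (\<sigma> ^^ j) a else \<zero>)"
  proof (rule finsum_cong')
    fix j assume "j \<in> {..<N}"
    then show "(\<Sum>i\<in>{0..<int N}. \<epsilon> powi (- i * int j) / of_nat N) \<odot> (\<sigma> ^^ j) a
        = (if 0 = j then (\<sigma> ^^ j) a else \<zero>)"
      using coeff[of j] smult_one[OF a] smult_l_null[OF carr] by simp
  qed (auto simp: a carr)
  also have "\<dots> = (\<sigma> ^^ 0) a"
    using N_pos carr by (intro finsum_singleton) auto
  finally show ?thesis by simp
qed

text \<open>The description in \<open>component\<close> is met by the projections:
  \<open>proj_sum\<close> gives existence and \<open>decomposition_unique\<close> uniqueness.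
  Restriction to the index range determines the function itself, not only its values there.\<close>

lemma component_in_E:
  assumes a: "a \<in> carrier L" and i: "i \<in> {0..<int N}"
  shows "component L \<sigma> N a i \<in> E i"
proof -
  let ?c = "restrict (\<lambda>i. proj i a) {0..<int N}"
  have sum: "a = (\<Oplus>i\<in>{0..<int N}. ?c i)"
  proof -
    have "(\<Oplus>i\<in>{0..<int N}. ?c i) = (\<Oplus>i\<in>{0..<int N}. proj i a)"
      by (rule finsum_cong') (auto intro: proj_closed a)
    then show ?thesis using proj_sum[OF a] by simp
  qed
  have "component L \<sigma> N a = ?c"
    unfolding component_def
  proof (rule the_equality)
    show "?c \<in> (\<Pi>\<^sub>E i\<in>{0..<int N}. E i) \<and> a = (\<Oplus>i\<in>{0..<int N}. ?c i)"
      using proj_in_E[OF a] by (intro conjI sum) auto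
  qed (use decomposition_unique in blast)
  then show ?thesis using i proj_in_E[OF a] by simp
qed

end

section \<open>Currents on evaluation modules\<close>

text \<open>A component chosen by the residue of the exponent is thereby a legitimate coefficient at
  every exponent with that residue.\<close>

lemma (in twisted_setup) E_mod: "E (k mod int N) = E k"
proof -
  have "\<epsilon> powi (k mod int N) = \<epsilon> powi k"
    by (simp only: eps_powi_mod[of k] eps_powi_mod[of "k mod int N"] mod_mod_trivial)
  then show ?thesis by (simp only: eigenspace_def)
qed

locale evaluation_module = twisted_setup L B \<sigma> N
  for L :: "('g, 'm) lie_alg_scheme" (structure) and B \<sigma> N +
  fixes I :: "'i set" and U :: "'i \<Rightarrow> (complex, 'u, 'n) module_scheme"
    and act :: "'i \<Rightarrow> 'g \<Rightarrow> 'u \<Rightarrow> 'u" and z \<zeta> :: "'i \<Rightarrow> complex"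
  assumes fin: "finite I" and mods: "\<And>i. i \<in> I \<Longrightarrow> lie_module L (U i) (act i)"
    and root: "\<And>i. i \<in> I \<Longrightarrow> \<zeta> i ^ N = z i" and z_nz: "\<And>i. i \<in> I \<Longrightarrow> z i \<noteq> 0"
begin

abbreviation eact :: "'i \<Rightarrow> (int \<Rightarrow> 'g) \<times> complex \<Rightarrow> 'u \<Rightarrow> 'u"
  where "eact \<equiv> \<lambda>i. eval_act L N (U i) (act i) (z i) (\<zeta> i)"

lemma tensor_lie_module: "tensor_lie_module A I U eact"
  by (intro tensor_lie_module.intro tensor_lie_module_axioms.intro lie_algebra_A fin
      lie_module_eval mods root z_nz)

text \<open>A shift of the degree by \<open>m\<close> periods contributes \<zeta>^(m N) = z^m, while
  the power of \<zeta> with exponent \<open>k\<close> is common to all \<open>m\<close>.\<close>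

lemma eact_homog:
  assumes i: "i \<in> I" and b: "b \<in> E (k + int m * int N)" and u: "u \<in> carrier (U i)"
  shows "eact i (homog b (k + int m * int N) c) u = (\<zeta> i powi k * z i ^ m) \<odot>\<^bsub>U i\<^esub> act i b u"
proof -
  have "\<zeta> i \<noteq> 0" using root[OF i] z_nz[OF i] N_pos by (auto simp: zero_power)
  then have "\<zeta> i powi (k + int m * int N) = \<zeta> i powi k * (\<zeta> i ^ N) ^ m"
    by (simp add: power_int_add power_int_mult mult.commute[of "int m"])
  then show ?thesis
    using eval_act_eq[OF mods root z_nz homog_A u, OF i i i b] ev_homog[OF b]
      lie_module.act_smult_left[OF mods[OF i] E_carrier[OF b] u] root[OF i]
    by simp
qed

lemma annihilates_evaluation:
  assumes p: "\<And>i. i \<in> I \<Longrightarrow> poly p (z i) = 0"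
  shows "annihilates_currents L \<sigma> N p (tensor_product I U) (tensor_act I U eact)"
  unfolding annihilates_currents_def
proof (intro ballI allI)
  interpret T: tensor_lie_module A I U eact by (rule tensor_lie_module)
  fix a w e assume a: "a \<in> carrier L" and w: "w \<in> carrier (tensor_product I U)"
  \<comment> \<open>The degree that meets x^(e/N) in the term m = 0. As x shifts exponents by
    \<open>N\<close>, the m-th term has degree k + m N; its residue, and with it the component
    \<open>b\<close>, is the same for all \<open>m\<close>.\<close>
  define k where "k = - e - int N"
  define b where "b = component L \<sigma> N a (k mod int N)"
  define X where "X m = homog b (k + int m * int N) 0" for m
  have "b \<in> E (k mod int N)"
    unfolding b_def using N_pos by (intro component_in_E a) auto
  then have b: "b \<in> E (k + int m * int N)" for m
    using E_mod[of k] E_mod[of "k + int m * int N"] by simp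
  have current: "current L \<sigma> N a (e - int m * int N) = X m" for m
  proof -
    have "- (e - int m * int N) - int N = k + int m * int N" by (simp add: k_def)
    then show ?thesis
      by (simp only: current_def Let_def loop_elt_def X_def homog_def b_def mod_mult_self1)
  qed
  have X: "X m \<in> carrier A" for m unfolding X_def by (rule homog_A[OF b])
  have rel: "(\<lambda>t. \<Sum>m\<le>degree p. coeff p m * T.der (X m) s t) \<in> T.R" if s: "s \<in> tuples I U" for s
  proof -
    define x where "x i = act i b (s i)" for i
    let ?c = "\<lambda>i m. \<zeta> i powi k * z i ^ m"
    have s_U: "s i \<in> carrier (U i)" if "i \<in> I" for i using s that by auto
    have x: "x i \<in> carrier (U i)" if "i \<in> I" for i
      unfolding x_def using lie_module.act_closed[OF mods[OF that] E_carrier[OF b]] s_U[OF that]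
      by simp
    \<comment> \<open>A scalar can leave its slot only at the cost of a scaling relation, which is
      kept as an explicit summand.\<close>
    have "T.der (X m) s t
        = (\<Sum>i\<in>I. T.smult_rel s i (?c i m) (x i) t + ?c i m * single (s(i := x i)) t)" for m t
      using eact_homog[OF _ b s_U, of _ _ 0] by (simp add: leibniz_def T.smult_rel_def X_def x_def)
    then have "(\<Sum>m\<le>degree p. coeff p m * T.der (X m) s t) =
        (\<Sum>m\<le>degree p. \<Sum>i\<in>I. coeff p m * T.smult_rel s i (?c i m) (x i) t)
        + (\<Sum>m\<le>degree p. \<Sum>i\<in>I. coeff p m * z i ^ m * (\<zeta> i powi k * single (s(i := x i)) t))" for t
      by (simp add: sum_distrib_left sum.distrib distrib_left mult_ac)
    \<comment> \<open>For fixed \<open>i\<close> the remaining factor does not depend on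
      \<open>m\<close>, so the sum over \<open>m\<close> evaluates \<open>p\<close> at
      \<open>z i\<close>. Since this value is 0, only the scaling relations are left.\<close>
    moreover have "(\<Sum>m\<le>degree p. \<Sum>i\<in>I. coeff p m * z i ^ m * (\<zeta> i powi k * single (s(i := x i)) t))
      = (\<Sum>i\<in>I. poly p (z i) * (\<zeta> i powi k * single (s(i := x i)) t))" for t
      by (subst sum.swap) (simp add: poly_altdef sum_distrib_right)
    ultimately have "(\<lambda>t. \<Sum>m\<le>degree p. coeff p m * T.der (X m) s t) =
        (\<lambda>t. \<Sum>m\<le>degree p. \<Sum>i\<in>I. coeff p m * T.smult_rel s i (?c i m) (x i) t)"
      using p by simp
    also have "\<dots> \<in> T.R"
      by (intro T.R_sum T.R_smult T.smult_rel_R s x)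
    finally show ?thesis .
  qed
  show "poly_times_series (tensor_product I U) N p
      (\<lambda>e'. tensor_act I U eact (current L \<sigma> N a e') w) e = \<zero>\<^bsub>tensor_product I U\<^esub>"
    unfolding poly_times_series_def current
    by (rule T.tensor_act_sum_eq_zero[OF _ X rel w]) auto
qed

end

theorem lemma3p3:
  fixes L :: "('g, 'm) lie_alg_scheme"
    and B :: "'g \<Rightarrow> 'g \<Rightarrow> complex"
    and \<sigma> :: "'g \<Rightarrow> 'g"
    and N r :: nat
    and nth_root :: "complex \<Rightarrow> complex"
    and U :: "nat \<Rightarrow> (complex, 'u, 'n) module_scheme"
    and act :: "nat \<Rightarrow> 'g \<Rightarrow> 'u \<Rightarrow> 'u"
    and z :: "nat \<Rightarrow> complex"
  assumes "simple_lie_algebra L" and "vectorspace.fin_dim \<complex> L"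
    and "normalized_invariant_form L B"
    and "lie_automorphism L \<sigma>" and "has_order L \<sigma> N"
    and "\<forall>w. w \<noteq> 0 \<longrightarrow> nth_root w ^ N = w"
    and "\<forall>i\<in>{1..r}. lie_module L (U i) (act i)"
    and "\<forall>i\<in>{1..r}. z i \<noteq> 0"
  defines "T \<equiv> tensor_product {1..r} U"
    and "T_act \<equiv> tensor_act {1..r} U (\<lambda>i. eval_act L N (U i) (act i) (z i) (nth_root (z i)))"
  shows "annihilates_currents L \<sigma> N (\<Prod>i=1..r. [:- z i, 1:]) T T_act
    \<and> category_E L B \<sigma> N T T_act"
proof -
  interpret evaluation_module L B \<sigma> N "{1..r}" U act z "\<lambda>i. nth_root (z i)"
    using assms(3-8)
    by (intro evaluation_module.intro evaluation_module_axioms.intro twisted_setup.intro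
        twisted_setup_axioms.intro) (auto simp: normalized_invariant_form_def)
  let ?p = "\<Prod>i=1..r. [:- z i, 1:]"
  \<comment> \<open>One vanishing factor suffices, so repeated points cause no difficulty. For r = 0
    the polynomial is 1, and every Leibniz sum is empty.\<close>
  have "poly ?p (z i) = 0" if "i \<in> {1..r}" for i
    using that by (auto simp: poly_prod)
  then have ann: "annihilates_currents L \<sigma> N ?p T T_act"
    unfolding T_def T_act_def by (rule annihilates_evaluation)
  moreover have "?p \<noteq> 0" by simp
  moreover have "lie_module (twisted_affine L B \<sigma> N) T T_act"
    unfolding T_def T_act_def
    by (rule tensor_lie_module.lie_module_tensor[OF tensor_lie_module])
  ultimately show ?thesis unfolding category_E_def by blast
qed

end
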